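(* For all $a\ge1$ and $\delta\ge0$ there is a constant $b\ge1$ depending only on $a$ and $\delta$ such that, for every positive integer $n$ and every proper subdomain $D\subsetneq\mathbb{R}^n$ that is $a$-John and $\delta$-hyperbolic, every quasihyperbolic geodesic in $D$ is a $b$-cone arc.
   Context: $D\subsetneq\mathbb R^n$ is a domain with the Euclidean metric, $d_D(z)=\operatorname{dist}(z,\partial D)$, and $\ell$ denotes Euclidean length. An arc is an embedded curve; for an arc $\gamma$ and $u,v\in\gamma$, $\gamma[u,v]$ is the subarc between $u$ and $v$. The quasihyperbolic length of a rectifiable curve $\gamma$ in $D$ is $\ell_k(\gamma)=\int_\gamma\frac{|dz|}{d_D(z)}$, and the quasihyperbolic metric is $k(x,y)=\inf\ell_k(\gamma)$ over all rectifiable curves $\gamma$ in $D$ joining $x$ and $y$. A quasihyperbolic geodesic is an arc $\gamma$ in $D$ with $\ell_k(\gamma[u,v])=k(u,v)$ for all $u,v\in\gamma$. A rectifiable arc $\alpha$ in $D$ with endpoints $x,y$ is an $a$-cone arc if $\min\{\ell(\alpha[x,z]),\ell(\alpha[z,y])\}\le a\,d_D(z)$ for all $z\in\alpha$. $D$ is $a$-John if each pair of points of $D$ can be joined by an $a$-cone arc in $D$. The domain $D$ is $\delta$-hyperbolic if the geodesic metric space $(D,k)$ is $\delta$-hyperbolic, that is, for all triples of geodesics $[x,y],[y,z],[z,x]$ of $(D,k)$, every point of $[x,y]$ is within $k$-distance $\delta$ of $[y,z]\cup[z,x]$. *)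

theory Defs
  imports "HOL-Analysis.Analysis"
begin

text \<open>
  The constant \<open>b\<close> must not depend on the dimension, so \<open>n\<close> has to be an ordinary number and
  not a type. We use the library space \<^const>\<open>Euclidean_space\<close> \<open>n\<close>: its points are the
  sequences vanishing from index \<open>n\<close> on. The metric on it is \<open>edist n\<close> below. The overloaded
  \<^const>\<open>dist\<close> on \<open>nat \<Rightarrow> real\<close> is a different metric and is never used; the product topology
  on \<open>nat \<Rightarrow> real\<close>, which underlies \<^const>\<open>path\<close> and \<^const>\<open>arc\<close>, does induce the Euclidean
  topology on these points.
\<close>

type_synonym point = "nat \<Rightarrow> real"
type_synonym curve = "real \<Rightarrow> point"

definition edist :: "nat \<Rightarrow> point \<Rightarrow> point \<Rightarrow> real" where
  "edist n x y = L2_set (\<lambda>i. x i - y i) {..<n}"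

definition proper_subdomain :: "nat \<Rightarrow> point set \<Rightarrow> bool" where
  "proper_subdomain n D \<longleftrightarrow>
     D \<noteq> {} \<and> openin (Euclidean_space n) D \<and> connectedin (Euclidean_space n) D \<and>
     D \<noteq> topspace (Euclidean_space n)"

definition bdist :: "nat \<Rightarrow> point set \<Rightarrow> point \<Rightarrow> real" where
  "bdist n D z = (INF w \<in> Euclidean_space n frontier_of D. edist n z w)"


subsection \<open>Length and quasihyperbolic length\<close>

text \<open>
  Curves are parametrised by \<open>{0..1}\<close>. The library's \<open>subpath\<close> is restricted to normed vector
  spaces; this is the same operation. For \<open>v < u\<close> the subcurve is traversed backwards.
\<close>

definition subcurve :: "real \<Rightarrow> real \<Rightarrow> curve \<Rightarrow> curve" where
  "subcurve u v \<gamma> = (\<lambda>t. \<gamma> ((v - u) * t + u))"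

definition polygonal_lengths :: "nat \<Rightarrow> curve \<Rightarrow> real set" where
  "polygonal_lengths n \<gamma> =
     {(\<Sum>i<m. edist n (\<gamma> (t i)) (\<gamma> (t (Suc i)))) | (m::nat) (t::nat \<Rightarrow> real).
        mono_on {..m} t \<and> t ` {..m} \<subseteq> {0..1}}"

definition rectifiable :: "nat \<Rightarrow> curve \<Rightarrow> bool" where
  "rectifiable n \<gamma> \<longleftrightarrow> path \<gamma> \<and> bdd_above (polygonal_lengths n \<gamma>)"

text \<open>Meaningful for rectifiable curves only.\<close>

definition curve_length :: "nat \<Rightarrow> curve \<Rightarrow> real" where
  "curve_length n \<gamma> = Sup (polygonal_lengths n \<gamma>)"

text \<open>
  The arc length parametrisation of a rectifiable curve: \<open>\<gamma>\<close> is constant on every set of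
  parameters \<open>t\<close> with the same length of \<open>subcurve 0 t \<gamma>\<close>, so the point is unique for
  \<open>0 \<le> s \<le> curve_length n \<gamma>\<close>.
\<close>

definition arclength_point :: "nat \<Rightarrow> curve \<Rightarrow> real \<Rightarrow> point" where
  "arclength_point n \<gamma> s =
     (THE x. \<exists>t\<in>{0..1}. curve_length n (subcurve 0 t \<gamma>) = s \<and> x = \<gamma> t)"

definition line_integral :: "nat \<Rightarrow> curve \<Rightarrow> (point \<Rightarrow> real) \<Rightarrow> real" where
  "line_integral n \<gamma> f = integral {0..curve_length n \<gamma>} (\<lambda>s. f (arclength_point n \<gamma> s))"

definition qh_length :: "nat \<Rightarrow> point set \<Rightarrow> curve \<Rightarrow> real" where
  "qh_length n D \<gamma> = line_integral n \<gamma> (\<lambda>z. 1 / bdist n D z)"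

definition qh_dist :: "nat \<Rightarrow> point set \<Rightarrow> point \<Rightarrow> point \<Rightarrow> real" where
  "qh_dist n D x y =
     Inf {qh_length n D \<gamma> | \<gamma>. rectifiable n \<gamma> \<and> path_image \<gamma> \<subseteq> D \<and>
                               pathstart \<gamma> = x \<and> pathfinish \<gamma> = y}"

text \<open>
  Quasihyperbolic length is defined for rectifiable curves, so rectifiability is part of the
  definition of a quasihyperbolic geodesic.
\<close>

definition qh_geodesic :: "nat \<Rightarrow> point set \<Rightarrow> curve \<Rightarrow> bool" where
  "qh_geodesic n D \<gamma> \<longleftrightarrow>
     arc \<gamma> \<and> path_image \<gamma> \<subseteq> D \<and> rectifiable n \<gamma> \<and>
     (\<forall>u\<in>{0..1}. \<forall>v\<in>{0..1}. qh_length n D (subcurve u v \<gamma>) = qh_dist n D (\<gamma> u) (\<gamma> v))"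


subsection \<open>John domains\<close>

definition cone_arc :: "nat \<Rightarrow> point set \<Rightarrow> real \<Rightarrow> curve \<Rightarrow> bool" where
  "cone_arc n D a \<alpha> \<longleftrightarrow>
     arc \<alpha> \<and> path_image \<alpha> \<subseteq> D \<and> rectifiable n \<alpha> \<and>
     (\<forall>t\<in>{0..1}. min (curve_length n (subcurve 0 t \<alpha>)) (curve_length n (subcurve t 1 \<alpha>))
                   \<le> a * bdist n D (\<alpha> t))"

text \<open>
  Distinctness is needed because \<^const>\<open>arc\<close> excludes one-point arcs; for \<open>x = y\<close> the one-point
  arc would satisfy the condition trivially.
\<close>

definition John :: "nat \<Rightarrow> point set \<Rightarrow> real \<Rightarrow> bool" where
  "John n D a \<longleftrightarrow>
     (\<forall>x\<in>D. \<forall>y\<in>D. x \<noteq> y \<longrightarrow>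
        (\<exists>\<alpha>. cone_arc n D a \<alpha> \<and> pathstart \<alpha> = x \<and> pathfinish \<alpha> = y))"


subsection \<open>Hyperbolicity\<close>

text \<open>
  \<open>geodesic_segment M d x y S\<close>: the set \<open>S\<close> is a geodesic \<open>[x,y]\<close> of the metric space \<open>(M,d)\<close>,
  that is, the image of an isometric embedding of an interval. Degenerate segments (\<open>x = y\<close>)
  are included.
\<close>

definition geodesic_segment ::
    "'a set \<Rightarrow> ('a \<Rightarrow> 'a \<Rightarrow> real) \<Rightarrow> 'a \<Rightarrow> 'a \<Rightarrow> 'a set \<Rightarrow> bool" where
  "geodesic_segment M d x y S \<longleftrightarrow>
     (\<exists>h. h 0 = x \<and> h (d x y) = y \<and> h ` {0..d x y} = S \<and> S \<subseteq> M \<and>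
          (\<forall>s\<in>{0..d x y}. \<forall>t\<in>{0..d x y}. d (h s) (h t) = \<bar>s - t\<bar>))"

definition hyperbolic_space :: "'a set \<Rightarrow> ('a \<Rightarrow> 'a \<Rightarrow> real) \<Rightarrow> real \<Rightarrow> bool" where
  "hyperbolic_space M d \<delta> \<longleftrightarrow>
     (\<forall>x\<in>M. \<forall>y\<in>M. \<forall>z\<in>M. \<forall>A B C.
        geodesic_segment M d x y A \<longrightarrow> geodesic_segment M d y z B \<longrightarrow> geodesic_segment M d z x C \<longrightarrow>
        (\<forall>p\<in>A. \<exists>q\<in>B \<union> C. d p q \<le> \<delta>))"

definition hyperbolic_domain :: "nat \<Rightarrow> point set \<Rightarrow> real \<Rightarrow> bool" where
  "hyperbolic_domain n D \<delta> \<longleftrightarrow> hyperbolic_space D (qh_dist n D) \<delta>"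

end

theory Submission
  imports Defs
begin

text \<open>
  Let \<open>d(z)\<close> be the boundary distance, \<open>x\<close>, \<open>y\<close> the endpoints of a quasihyperbolic geodesic \<open>\<gamma>\<close> and
  \<open>m\<close> the midpoint of a cone arc joining them. On the half of the cone arc from \<open>x\<close> to \<open>m\<close>, at arc
  length \<open>s\<close> from \<open>x\<close>, \<open>d\<close> is comparable to \<open>d(x) + s\<close>. Hence this half is a quasihyperbolic
  quasi-geodesic along which the \<open>k\<close>-Lipschitz function \<open>log d\<close> grows linearly; likewise from \<open>y\<close>.
  By thin triangles every point \<open>p\<close> of \<open>\<gamma>\<close> is close to \<open>[x,m]\<close> or \<open>[m,y]\<close>, say to \<open>[x,m]\<close>, and by
  stability of quasi-geodesics \<open>\<gamma>[x,p]\<close> stays close to the half of the cone arc, without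
  passing its point nearest to \<open>p\<close>. So \<open>d(q) \<le> C d(p) exp (-c k(q,p))\<close> for \<open>q\<close> in \<open>\<gamma>[x,p]\<close>, and as
  \<open>|dq| = d(q) dk\<close>, integration bounds the Euclidean length of \<open>\<gamma>[x,p]\<close> by a multiple of \<open>d(p)\<close>.
  All estimates take place in \<open>(D,k)\<close>, hence do not see the dimension.
\<close>

subsection \<open>Hyperbolic geodesic spaces\<close>

text \<open>Hyperbolicity speaks about geodesics of \<open>(D,k)\<close> only, so a cone arc enters
  through finitely many rungs. \<open>log d\<close> does two jobs: being \<open>k\<close>-Lipschitz,
  it converts its own growth along the rungs into the lower bound on \<open>k\<close>-distances that
  a quasi-geodesic needs; and its decay along \<open>\<gamma>\<close> is what is integrated in the
  end. Which half of the cone arc is close to a given \<open>p\<close> cannot be prescribed; the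
  minimum in the cone condition absorbs that choice. Thin triangles say nothing unless geodesics
  exist, so their existence in \<open>(D,k)\<close> has to be proved. As \<open>n\<close> is a
  number and \<open>k\<close> an infimum over parametrised curves, length, arc length and
  compactness are developed for sequences with \<open>n\<close> free coordinates.\<close>

text \<open>With \<open>2 ^ m\<close> about \<open>A * r + B\<close>, the premise bounds
  \<open>r\<close> by a logarithm of itself. Quantifying over \<open>m\<close> keeps logarithms out
  of the uses; in the proof a square root is a good enough substitute for the logarithm.\<close>

lemma log_absorption:
  fixes A B \<delta> M :: real
  assumes "A > 0" "B \<ge> 0" "\<delta> \<ge> 0" "M \<ge> 0"
  shows "\<exists>R\<ge>0. \<forall>r\<ge>0. (\<forall>m::nat. A * r + B \<le> 2 ^ m \<longrightarrow> r \<le> 2 * \<delta> + \<delta> * m + M) \<longrightarrow> r \<le> R"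
proof -
  define R where "R = 2 * (4 * \<delta> + M) + B / A + 4 * \<delta>\<^sup>2 * A"
  have "r \<le> R" if r: "r \<ge> 0" and H: "\<And>m::nat. A * r + B \<le> 2 ^ m \<Longrightarrow> r \<le> 2 * \<delta> + \<delta> * m + M" for r
  proof -
    define w where "w = sqrt (A * r + B)"
    have w: "0 \<le> w" "w\<^sup>2 = A * r + B" using assms r by (auto simp: w_def)
    \<comment> \<open>\<open>m < 2 ^ m\<close> gives \<open>w \<le> 2 ^ m\<close>; squaring makes
      \<open>2 * m\<close> admissible in the premise.\<close>
    define m where "m = nat \<lceil>w\<rceil>"
    have m: "w \<le> m" "m \<le> w + 1" using w by (simp_all add: m_def)
    have "w \<le> 2 ^ m" using m(1) of_nat_less_two_power[of m, where 'a=real] by linarith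
    then have "w\<^sup>2 \<le> (2 ^ m)\<^sup>2" using w(1) by (intro power_mono) auto
    then have "A * r + B \<le> 2 ^ (2 * m)" unfolding w(2) power_even_eq .
    then have "r \<le> 2 * \<delta> + \<delta> * real (2 * m) + M" by (rule H)
    also have "\<delta> * real (2 * m) \<le> \<delta> * (2 * w + 2)"
      using m(2) assms by (intro mult_left_mono) auto
    finally have "r \<le> 4 * \<delta> + M + 2 * \<delta> * w" by (simp add: algebra_simps)
    \<comment> \<open>Half of \<open>r\<close> is absorbed: \<open>w\<^sup>2 / (2 * A)\<close>
      contains \<open>r / 2\<close>, and solving for \<open>r\<close> gives
      \<open>R\<close>.\<close>
    moreover have "2 * \<delta> * w * (2 * A) \<le> w\<^sup>2 + 4 * \<delta>\<^sup>2 * A\<^sup>2"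
      using sum_squares_ge_zero[of "w - 2 * \<delta> * A" 0] by (simp add: power2_eq_square algebra_simps)
    then have "2 * \<delta> * w \<le> (w\<^sup>2 + 4 * \<delta>\<^sup>2 * A\<^sup>2) / (2 * A)" using assms by (simp add: pos_le_divide_eq)
    moreover have "(w\<^sup>2 + 4 * \<delta>\<^sup>2 * A\<^sup>2) / (2 * A) = r / 2 + B / A / 2 + 2 * \<delta>\<^sup>2 * A"
      unfolding w(2) using assms by (simp add: field_simps power2_eq_square)
    ultimately show ?thesis unfolding R_def by simp
  qed
  moreover have "R \<ge> 0" using assms by (simp add: R_def)
  ultimately show ?thesis by blast
qed

lemma geodesic_segmentE:
  assumes "geodesic_segment M d x y S"
  obtains h where "h 0 = x" "h (d x y) = y" "h ` {0..d x y} = S" "S \<subseteq> M"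
    "\<And>s t. s \<in> {0..d x y} \<Longrightarrow> t \<in> {0..d x y} \<Longrightarrow> d (h s) (h t) = \<bar>s - t\<bar>"
  using assms unfolding geodesic_segment_def by blast

text \<open>Carrier and distance are explicit because \<open>n\<close> and \<open>D\<close> vary
  inside the theorem, so \<open>k\<close> cannot be a type class metric.\<close>

locale geodesic_space =
  fixes M :: "'a set" and d :: "'a \<Rightarrow> 'a \<Rightarrow> real"
  assumes nonneg: "x \<in> M \<Longrightarrow> y \<in> M \<Longrightarrow> 0 \<le> d x y"
    and refl: "x \<in> M \<Longrightarrow> d x x = 0"
    and commute: "d x y = d y x"
    and triangle: "x \<in> M \<Longrightarrow> y \<in> M \<Longrightarrow> z \<in> M \<Longrightarrow> d x z \<le> d x y + d y z"
    and geodesic_exists: "x \<in> M \<Longrightarrow> y \<in> M \<Longrightarrow> \<exists>S. geodesic_segment M d x y S"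
begin

lemma geodesic_segment_sym:
  assumes "geodesic_segment M d x y S"
  shows "geodesic_segment M d y x S"
proof -
  obtain h where h: "h 0 = x" "h (d x y) = y" "h ` {0..d x y} = S" "S \<subseteq> M"
    "\<And>s t. s \<in> {0..d x y} \<Longrightarrow> t \<in> {0..d x y} \<Longrightarrow> d (h s) (h t) = \<bar>s - t\<bar>"
    using geodesic_segmentE[OF assms] by blast
  have img: "(\<lambda>s. d x y - s) ` {0..d x y} = {0..d x y}"
    by (auto simp: image_iff intro!: bexI[of _ "d x y - _"])
  have "(\<lambda>s. h (d x y - s)) ` {0..d x y} = S"
    using h(3) img by (metis image_image)
  then show ?thesis
    unfolding geodesic_segment_def commute[of y x]
    by (intro exI[of _ "\<lambda>s. h (d x y - s)"]) (use h in auto)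
qed

lemma geodesic_segment_sub:
  assumes "\<And>s t. s \<in> {0..l} \<Longrightarrow> t \<in> {0..l} \<Longrightarrow> d (h s) (h t) = \<bar>s - t\<bar>"
    and "h ` {0..l} \<subseteq> M" "0 \<le> u" "u \<le> v" "v \<le> l"
  shows "geodesic_segment M d (h u) (h v) (h ` {u..v})"
proof -
  have duv: "d (h u) (h v) = v - u" using assms by auto
  have "(\<lambda>s. u + s) ` {0..v - u} = {u..v}" by simp
  then have "(\<lambda>s. h (u + s)) ` {0..v - u} = h ` {u..v}" by (metis image_image)
  then show ?thesis
    unfolding geodesic_segment_def duv
    by (intro exI[of _ "\<lambda>s. h (u + s)"]) (use assms in auto)
qed

lemma geodesic_segment_dist:
  assumes "geodesic_segment M d x y S" "p \<in> S"
  shows "d x p + d p y = d x y"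
proof -
  obtain h where h: "h 0 = x" "h (d x y) = y" "h ` {0..d x y} = S" "S \<subseteq> M"
    "\<And>s t. s \<in> {0..d x y} \<Longrightarrow> t \<in> {0..d x y} \<Longrightarrow> d (h s) (h t) = \<bar>s - t\<bar>"
    using geodesic_segmentE[OF assms(1)] by blast
  obtain u where u: "u \<in> {0..d x y}" "p = h u" using h(3) assms(2) by blast
  have "d (h 0) (h u) = u" "d (h u) (h (d x y)) = d x y - u"
    using h(5)[of 0 u] h(5)[of u "d x y"] u by auto
  then show ?thesis using u h by simp
qed

lemma geodesic_segment_subset:
  "geodesic_segment M d x y S \<Longrightarrow> S \<subseteq> M"
  unfolding geodesic_segment_def by blast

end

locale hyperbolic_geodesic_space = geodesic_space +
  fixes \<delta> :: real
  assumes delta_nonneg: "\<delta> \<ge> 0"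
    and thin: "hyperbolic_space M d \<delta>"
begin

lemma thin_triangle:
  assumes "x \<in> M" "y \<in> M" "z \<in> M" "geodesic_segment M d x y A" "geodesic_segment M d y z B"
    "geodesic_segment M d z x C" "p \<in> A"
  obtains q where "q \<in> B \<union> C" "d p q \<le> \<delta>"
proof -
  from thin[unfolded hyperbolic_space_def, rule_format, OF assms] show thesis using that by blast
qed

text \<open>Each bisection of the chain costs one \<open>\<delta>\<close>, since a thin triangle
  moves \<open>p\<close> to a geodesic spanning one half. The resulting logarithm of the number of
  steps is what stability plays against linear growth.\<close>

lemma geodesic_near_chain:
  assumes "i \<le> j" "j - i \<le> 2 ^ m" "\<And>l. i \<le> l \<Longrightarrow> l \<le> j \<Longrightarrow> z l \<in> M"
    and "\<And>l. i \<le> l \<Longrightarrow> l < j \<Longrightarrow> d (z l) (z (Suc l)) \<le> K" "K \<ge> 0"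
    and "geodesic_segment M d (z i) (z j) S" "p \<in> S"
  shows "\<exists>l\<in>{i..j}. d p (z l) \<le> \<delta> * m + K"
  using assms
proof (induction m arbitrary: i j S p)
  case 0
  have "d (z i) (z j) \<le> K"
  proof (cases "j = i")
    case True then show ?thesis using 0 refl by simp
  next
    case False then have "j = Suc i" using 0 by simp
    then show ?thesis using 0 by simp
  qed
  moreover have "p \<in> M" using 0 geodesic_segment_subset by blast
  then have "d (z i) p \<le> d (z i) (z j)"
    using geodesic_segment_dist[OF 0(6,7)] nonneg[of p "z j"] 0 by simp
  ultimately show ?case using 0 commute[of p] by (intro bexI[of _ i]) auto
next
  case (Suc m)
  define c where "c = (i + j) div 2"
  have c: "i \<le> c" "c \<le> j" "c - i \<le> 2 ^ m" "j - c \<le> 2 ^ m"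
    using Suc.prems(1,2) by (auto simp: c_def)
  have zM: "z i \<in> M" "z c \<in> M" "z j \<in> M" using Suc.prems(3) c by auto
  obtain B C where B: "geodesic_segment M d (z j) (z c) B" and C: "geodesic_segment M d (z c) (z i) C"
    using geodesic_exists zM by meson
  obtain q where q: "q \<in> B \<union> C" "d p q \<le> \<delta>"
    using thin_triangle[OF zM(1,3,2) Suc.prems(6) B C Suc.prems(7)] .
  have "\<exists>l\<in>{i..j}. d q (z l) \<le> \<delta> * m + K"
  proof (cases "q \<in> B")
    case True
    have "\<exists>l\<in>{c..j}. d q (z l) \<le> \<delta> * m + K"
      by (rule Suc.IH[OF c(2,4) _ _ _ geodesic_segment_sym[OF B] True]) (use Suc.prems c in auto)
    then show ?thesis using c by force
  next
    case False
    then have qC: "q \<in> C" using q by blast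
    have "\<exists>l\<in>{i..c}. d q (z l) \<le> \<delta> * m + K"
      by (rule Suc.IH[OF c(1,3) _ _ _ geodesic_segment_sym[OF C] qC]) (use Suc.prems c in auto)
    then show ?thesis using c by force
  qed
  then obtain l where l: "l \<in> {i..j}" "d q (z l) \<le> \<delta> * m + K" by blast
  have "p \<in> M" "q \<in> M" "z l \<in> M"
    using Suc.prems l q B C geodesic_segment_subset by (blast, blast, auto)
  then have "d p (z l) \<le> d p q + d q (z l)" by (rule triangle)
  then show ?case using l q by (intro bexI[of _ l]) (auto simp: algebra_simps)
qed

text \<open>Stability of quasi-geodesics: the point \<open>p0\<close> of the geodesic farthest from the chain
  is avoided, at scale \<open>r\<close>, by a detour of length linear in \<open>r\<close>, which thin triangles allow only
  if \<open>r\<close> is at most logarithmic in that length.\<close>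

lemma geodesic_near_quasigeodesic:
  assumes R: "\<And>r. r \<ge> 0 \<Longrightarrow> (\<And>m::nat. A * 6 * r + B \<le> 2 ^ m \<Longrightarrow> r \<le> 2 * \<delta> + \<delta> * m + K) \<Longrightarrow> r \<le> R"
    and "A \<ge> 0" "B \<ge> 0" "K \<ge> 0"
    and zM: "\<And>l. l \<le> N \<Longrightarrow> z l \<in> M"
    and step: "\<And>l. l < N \<Longrightarrow> d (z l) (z (Suc l)) \<le> K"
    and qg: "\<And>i j. i \<le> j \<Longrightarrow> j \<le> N \<Longrightarrow> real j - real i \<le> A * d (z i) (z j) + B"
    and S: "geodesic_segment M d (z 0) (z N) S" "p \<in> S"
  shows "\<exists>l\<le>N. d p (z l) \<le> R"
proof -
  define L where "L = d (z 0) (z N)"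
  obtain h where h: "h 0 = z 0" "h L = z N" "h ` {0..L} = S" "S \<subseteq> M"
    "\<And>s t. s \<in> {0..L} \<Longrightarrow> t \<in> {0..L} \<Longrightarrow> d (h s) (h t) = \<bar>s - t\<bar>"
    using geodesic_segmentE[OF S(1)] unfolding L_def by blast
  have L0: "L \<ge> 0" using nonneg zM L_def by simp
  have hM: "h s \<in> M" if "s \<in> {0..L}" for s using h(3,4) that by blast
  \<comment> \<open>Distance to the chain, attained because the chain is finite. It is 1-Lipschitz
    along the geodesic, so a farthest point exists by compactness.\<close>
  define F where "F s = Min ((\<lambda>l. d (h s) (z l)) ` {..N})" for s
  have Fle: "F s \<le> d (h s) (z l)" if "l \<le> N" for s l
    unfolding F_def using that by (intro Min_le) auto
  have Fex: "\<exists>l\<le>N. F s = d (h s) (z l)" for s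
  proof -
    have "F s \<in> (\<lambda>l. d (h s) (z l)) ` {..N}" unfolding F_def by (rule Min_in) auto
    then show ?thesis by auto
  qed
  have Flip: "F s \<le> F t + \<bar>s - t\<bar>" if "s \<in> {0..L}" "t \<in> {0..L}" for s t
  proof -
    obtain l where l: "l \<le> N" "F t = d (h t) (z l)" using Fex by blast
    have "F s \<le> d (h s) (z l)" using Fle l by blast
    also have "\<dots> \<le> d (h s) (h t) + d (h t) (z l)" using triangle hM that zM l by blast
    finally show ?thesis using l h(5) that by simp
  qed
  have "continuous_on {0..L} F"
    unfolding continuous_on_iff
  proof (intro ballI allI impI)
    fix s e :: real assume "s \<in> {0..L}" "e > 0"
    moreover have "\<bar>F t - F s\<bar> \<le> \<bar>t - s\<bar>" if "t \<in> {0..L}" for t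
      using Flip[of s t] Flip[of t s] that \<open>s \<in> {0..L}\<close> by linarith
    ultimately show "\<exists>k>0. \<forall>t\<in>{0..L}. dist t s < k \<longrightarrow> dist (F t) (F s) < e"
      by (intro exI[of _ e]) (force simp: dist_real_def)
  qed
  then obtain u0 where u0: "u0 \<in> {0..L}" "\<And>u. u \<in> {0..L} \<Longrightarrow> F u \<le> F u0"
    using continuous_attains_sup[of "{0..L}" F] L0 by auto
  define r where "r = F u0"
  define p0 where "p0 = h u0"
  have p0M: "p0 \<in> M" using hM u0 p0_def by blast
  have far: "r \<le> d p0 (z l)" if "l \<le> N" for l using Fle that unfolding r_def p0_def by blast
  have r0: "r \<ge> 0"
    using Fex[of u0] nonneg[OF p0M zM] by (auto simp: r_def p0_def)
  \<comment> \<open>Distance \<open>2 * r\<close> leaves room for connections of length at most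
    \<open>r\<close> to the chain that stay \<open>r\<close> away from \<open>p0\<close>. If the
    geodesic ends earlier, its end is itself a chain point and the connection is degenerate.\<close>
  define t1 t2 where "t1 = max 0 (u0 - 2 * r)" and "t2 = min L (u0 + 2 * r)"
  have t: "0 \<le> t1" "t1 \<le> u0" "u0 \<le> t2" "t2 \<le> L" "t2 - t1 \<le> 4 * r"
    using u0 r0 L0 by (auto simp: t1_def t2_def)
  define y1 y2 where "y1 = h t1" and "y2 = h t2"
  have yM: "y1 \<in> M" "y2 \<in> M" using hM t by (auto simp: y1_def y2_def)
  obtain l1 where l1: "l1 \<le> N" "d y1 (z l1) \<le> r" "t1 = u0 - 2 * r \<or> y1 = z l1"
  proof (cases "u0 - 2 * r \<le> 0")
    case True
    then have "y1 = z 0" using h by (simp add: y1_def t1_def)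
    then show ?thesis using that[of 0] refl[OF zM] r0 by simp
  next
    case False
    then have "t1 = u0 - 2 * r" by (simp add: t1_def)
    moreover have "F t1 \<le> r" using u0(2)[of t1] t u0 by (simp add: r_def)
    ultimately show ?thesis using that Fex[of t1] unfolding y1_def by metis
  qed
  obtain l2 where l2: "l2 \<le> N" "d y2 (z l2) \<le> r" "t2 = u0 + 2 * r \<or> y2 = z l2"
  proof (cases "L \<le> u0 + 2 * r")
    case True
    then have "y2 = z N" using h by (simp add: y2_def t2_def)
    then show ?thesis using that[of N] refl[OF zM] r0 by simp
  next
    case False
    then have "t2 = u0 + 2 * r" by (simp add: t2_def)
    moreover have "F t2 \<le> r" using u0(2)[of t2] t u0 by (simp add: r_def)
    ultimately show ?thesis using that Fex[of t2] unfolding y2_def by metis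
  qed
  have d1: "d p0 y1 = u0 - t1" "d p0 y2 = t2 - u0" "d y1 y2 = t2 - t1"
    using h(5) t unfolding p0_def y1_def y2_def by auto
  have side: "r \<le> d p0 q"
    if "geodesic_segment M d y (z l) C" "q \<in> C" "y \<in> M" "l \<le> N" "d y (z l) \<le> r"
      "2 * r \<le> d p0 y \<or> y = z l" for y l C q
  proof -
    have qM: "q \<in> M" using that geodesic_segment_subset by blast
    have qd: "d y q + d q (z l) = d y (z l)" using geodesic_segment_dist that by blast
    have nn: "d y q \<ge> 0" "d q (z l) \<ge> 0" using nonneg that qM zM by auto
    show ?thesis using that(6)
    proof
      assume "2 * r \<le> d p0 y"
      moreover have "d p0 y \<le> d p0 q + d q y" using triangle p0M qM that by blast
      ultimately show ?thesis using qd nn that commute[of q y] by linarith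
    next
      assume "y = z l"
      then have "d q (z l) = 0" using qd nn refl[OF zM] that by simp
      moreover have "d p0 (z l) \<le> d p0 q + d q (z l)" using triangle p0M qM zM that by blast
      ultimately show ?thesis using far[OF that(4)] by simp
    qed
  qed
  have z1M: "z l1 \<in> M" and z2M: "z l2 \<in> M" using zM l1 l2 by auto
  have "d y1 (z l2) \<le> d y1 y2 + d y2 (z l2)" "d (z l1) (z l2) \<le> d (z l1) y1 + d y1 (z l2)"
    using triangle yM z1M z2M by auto
  \<comment> \<open>\<open>r + 4 * r + r\<close>: the factor 6 in the hypothesis on
    \<open>R\<close>.\<close>
  then have d12: "d (z l1) (z l2) \<le> 6 * r"
    using d1 l1 l2 t commute[of "z l1" y1] by linarith
  have segy: "geodesic_segment M d y1 y2 (h ` {t1..t2})"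
    unfolding y1_def y2_def by (rule geodesic_segment_sub[of L]) (use h t in auto)
  have p0in: "p0 \<in> h ` {t1..t2}" using t by (auto simp: p0_def)
  obtain B1 where B1: "geodesic_segment M d y2 (z l2) B1" using geodesic_exists yM z2M by blast
  obtain B2 where B2: "geodesic_segment M d (z l2) y1 B2" using geodesic_exists yM z2M by blast
  obtain B3 where B3: "geodesic_segment M d y1 (z l1) B3" using geodesic_exists yM z1M by blast
  obtain B4 where B4: "geodesic_segment M d (z l1) (z l2) B4" using geodesic_exists z1M z2M by blast
  \<comment> \<open>Cutting the quadrilateral \<open>y1\<close>, \<open>y2\<close>,
    \<open>z l2\<close>, \<open>z l1\<close> along a diagonal puts \<open>p0\<close> within
    \<open>2 * \<delta>\<close> of one of the other three sides. The two connections are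
    \<open>r\<close> away from it, and the third side stays close to the chain.\<close>
  have "r \<le> 2 * \<delta> + \<delta> * m + K" if m: "A * 6 * r + B \<le> 2 ^ m" for m :: nat
  proof -
    obtain q where q: "q \<in> B1 \<union> B2" "d p0 q \<le> \<delta>"
      using thin_triangle[OF yM z2M segy B1 B2 p0in] .
    have pos: "0 \<le> \<delta> * m" using delta_nonneg by simp
    show ?thesis
    proof (cases "q \<in> B1")
      case True
      then have "r \<le> d p0 q" using side[OF B1 _ yM(2) l2(1,2)] l2(3) d1 by auto
      then show ?thesis using q pos delta_nonneg \<open>K \<ge> 0\<close> by linarith
    next
      case False
      then have qB2: "q \<in> B2" using q by blast
      obtain q' where q': "q' \<in> B3 \<union> B4" "d q q' \<le> \<delta>"
        using thin_triangle[OF z2M yM(1) z1M B2 B3 B4 qB2] .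
      have qM: "q \<in> M" "q' \<in> M"
        using qB2 q' B2 B3 B4 geodesic_segment_subset by blast+
      then have pq': "d p0 q' \<le> 2 * \<delta>"
        using triangle[OF p0M qM] q q' by linarith
      show ?thesis
      proof (cases "q' \<in> B3")
        case True
        then have "r \<le> d p0 q'" using side[OF B3 _ yM(1) l1(1,2)] l1(3) d1 by auto
        then show ?thesis using pq' pos \<open>K \<ge> 0\<close> by linarith
      next
        case False
        then have q'B4: "q' \<in> B4" using q' by blast
        have A6: "A * d (z l1) (z l2) \<le> A * (6 * r)" using d12 \<open>A \<ge> 0\<close> by (rule mult_left_mono)
        \<comment> \<open>The two chain points may come in either order.\<close>
        have "\<exists>l\<le>N. d q' (z l) \<le> \<delta> * m + K"
        proof (cases "l1 \<le> l2")
          case True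
          have "real (l2 - l1) \<le> real (2 ^ m)" using qg[OF True l2(1)] True A6 m by (simp add: of_nat_diff)
          then have "l2 - l1 \<le> 2 ^ m" by (rule of_nat_le_iff[THEN iffD1])
          then have "\<exists>l\<in>{l1..l2}. d q' (z l) \<le> \<delta> * m + K"
            by (rule geodesic_near_chain[OF True _ _ _ \<open>K \<ge> 0\<close> B4 q'B4])
              (use zM step l1(1) l2(1) in auto)
          then show ?thesis using l2(1) by (meson atLeastAtMost_iff order_trans)
        next
          case False
          then have F: "l2 \<le> l1" by simp
          have "real (l1 - l2) \<le> real (2 ^ m)"
            using qg[OF F l1(1)] F A6 m commute[of "z l1" "z l2"] by (simp add: of_nat_diff)
          then have "l1 - l2 \<le> 2 ^ m" by (rule of_nat_le_iff[THEN iffD1])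
          then have "\<exists>l\<in>{l2..l1}. d q' (z l) \<le> \<delta> * m + K"
            by (rule geodesic_near_chain[OF F _ _ _ \<open>K \<ge> 0\<close> geodesic_segment_sym[OF B4] q'B4])
              (use zM step l1(1) l2(1) in auto)
          then show ?thesis using l1(1) by (meson atLeastAtMost_iff order_trans)
        qed
        then obtain l where l: "l \<le> N" "d q' (z l) \<le> \<delta> * m + K" by blast
        have "d p0 (z l) \<le> d p0 q' + d q' (z l)" using triangle p0M qM zM l by blast
        then show ?thesis using far[OF l(1)] l pq' by linarith
      qed
    qed
  qed
  then have "r \<le> R" using R[OF r0] by blast
  moreover obtain u where u: "u \<in> {0..L}" "p = h u" using S(2) h(3) by blast
  ultimately show ?thesis
    using u0(2)[OF u(1)] Fex[of u] unfolding u(2) r_def by (metis order_trans)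
qed

lemma geodesic_initial_segment:
  assumes S: "geodesic_segment M d x y S" and "p \<in> S" "q \<in> S" "d x q \<le> d x p"
    and M: "x \<in> M" "y \<in> M"
  shows "\<exists>T. geodesic_segment M d x p T \<and> q \<in> T"
proof -
  obtain h where h: "h 0 = x" "h (d x y) = y" "h ` {0..d x y} = S" "S \<subseteq> M"
    "\<And>s t. s \<in> {0..d x y} \<Longrightarrow> t \<in> {0..d x y} \<Longrightarrow> d (h s) (h t) = \<bar>s - t\<bar>"
    using geodesic_segmentE[OF S] by blast
  obtain u v where u: "u \<in> {0..d x y}" "p = h u" and v: "v \<in> {0..d x y}" "q = h v"
    using h(3) assms(2,3) by blast
  have "d x p = u" "d x q = v" using h(5)[of 0 u] h(5)[of 0 v] u v h(1) by auto
  then have "v \<le> u" using assms by simp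
  then show ?thesis
    using geodesic_segment_sub[of "d x y" h 0 u] h u v by (intro exI[of _ "h ` {0..u}"]) auto
qed

end

section \<open>Height functions and ladders\<close>

text \<open>\<open>R\<close> is a parameter so that one value, supplied by \<open>log_absorption\<close>, serves all spaces with the same
  \<open>\<delta>\<close> and \<open>K\<close>.\<close>

locale height_space = hyperbolic_geodesic_space +
  fixes f :: "'a \<Rightarrow> real" and K R :: real
  assumes height_lipschitz: "p \<in> M \<Longrightarrow> q \<in> M \<Longrightarrow> \<bar>f p - f q\<bar> \<le> d p q"
    and K_ge_1: "K \<ge> 1"
    and R_nonneg: "R \<ge> 0"
    and R_absorbs: "r \<ge> 0 \<Longrightarrow> (\<And>m::nat. 12 * r + 4 * K \<le> 2 ^ m \<Longrightarrow> r \<le> 2 * \<delta> + \<delta> * m + K) \<Longrightarrow> r \<le> R"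
begin

text \<open>A discrete quasi-geodesic climbing by \<open>ln 2\<close> per rung, as the boundary
  distance roughly doubles there. Heights are compared with the bottom rung and not with the
  previous one, so errors do not accumulate and initial parts are again ladders.\<close>

definition ladder :: "nat \<Rightarrow> (nat \<Rightarrow> 'a) \<Rightarrow> bool" where
  "ladder N z \<longleftrightarrow> (\<forall>l\<le>N. z l \<in> M) \<and> (\<forall>l<N. d (z l) (z (Suc l)) \<le> K) \<and>
     (\<forall>l\<le>N. \<bar>f (z l) - f (z 0) - l * ln 2\<bar> \<le> K)"

lemma ladder_truncate: "ladder N z \<Longrightarrow> i \<le> N \<Longrightarrow> ladder i z"
  unfolding ladder_def by auto

lemma ladder_dist_le:
  assumes "ladder N z" "i \<le> j" "j \<le> N"
  shows "d (z i) (z j) \<le> K * (real j - real i)"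
  using assms(2,3)
proof (induction j rule: dec_induct)
  case base
  then show ?case using assms refl by (simp add: ladder_def)
next
  case (step j)
  have "d (z i) (z (Suc j)) \<le> d (z i) (z j) + d (z j) (z (Suc j))"
    using assms step by (intro triangle) (auto simp: ladder_def)
  moreover have "d (z j) (z (Suc j)) \<le> K" using assms step by (auto simp: ladder_def)
  ultimately show ?case using step by (simp add: algebra_simps)
qed

text \<open>Growth of a Lipschitz height forces rungs apart: \<open>d (z i) (z j)\<close> is at
  least \<open>(j - i) * ln 2 - 2 * K\<close>. As \<open>ln 2 \<ge> 1/2\<close>, this is the
  quasi-geodesic estimate with \<open>A = 2\<close> and \<open>B = 4 * K\<close>, the origin of
  \<open>12 * r + 4 * K\<close> in \<open>R_absorbs\<close>.\<close>

lemma geodesic_near_ladder: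
  assumes "ladder N z" "geodesic_segment M d (z 0) (z N) S" "p \<in> S"
  shows "\<exists>l\<le>N. d p (z l) \<le> R"
proof (rule geodesic_near_quasigeodesic[where A=2 and B="4 * K" and K=K])
  fix i j assume ij: "i \<le> j" "j \<le> N"
  then have "\<bar>f (z i) - f (z j)\<bar> \<le> d (z i) (z j)"
    using assms by (intro height_lipschitz) (auto simp: ladder_def)
  moreover have "\<bar>f (z i) - f (z 0) - i * ln 2\<bar> \<le> K" "\<bar>f (z j) - f (z 0) - j * ln 2\<bar> \<le> K"
    using assms ij by (auto simp: ladder_def)
  ultimately have "(real j - real i) * ln 2 \<le> d (z i) (z j) + 2 * K"
    by (simp add: left_diff_distrib abs_le_iff)
  moreover have "(real j - real i) * (1 / 2) \<le> (real j - real i) * ln 2"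
    using ij ln2_ge_two_thirds by (intro mult_left_mono) auto
  ultimately show "real j - real i \<le> 2 * d (z i) (z j) + 4 * K" by simp
next
  fix r :: real
  assume "0 \<le> r" "\<And>m::nat. 2 * 6 * r + 4 * K \<le> 2 ^ m \<Longrightarrow> r \<le> 2 * \<delta> + \<delta> * real m + K"
  then show "r \<le> R" using R_absorbs by simp
qed (use assms K_ge_1 in \<open>auto simp: ladder_def\<close>)

text \<open>Loss of height and distance from \<open>q\<close> to \<open>p\<close> are both
  controlled by a number of rungs, and eliminating it gives the rate: a rung costs at most
  \<open>K\<close> in distance and gains \<open>ln 2 \<ge> 1/2\<close> in height, hence
  \<open>1 / (2 * K)\<close>. The two estimates contribute \<open>3 * (R + \<delta>)\<close> each,
  which the factor 8 covers.\<close>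

lemma height_growth_near_ladder:
  assumes z: "ladder N z" and i: "i \<le> N" "d p (z i) \<le> R + \<delta>" and pM: "p \<in> M"
    and S: "geodesic_segment M d (z 0) p S" "q \<in> S"
  shows "f q \<le> f p - d q p / (2 * K) + 2 * K + 8 * (R + \<delta>)"
proof -
  have zM: "z l \<in> M" if "l \<le> N" for l using z that by (simp add: ladder_def)
  obtain B C where B: "geodesic_segment M d p (z i) B" and C: "geodesic_segment M d (z i) (z 0) C"
    using geodesic_exists zM i pM by (metis le0)
  obtain q' where q': "q' \<in> B \<union> C" "d q q' \<le> \<delta>"
    using thin_triangle[OF zM[of 0] pM zM[OF i(1)] S(1) B C S(2)] by auto
  have qM: "q \<in> M" "q' \<in> M" using S q' B C geodesic_segment_subset by blast+
  \<comment> \<open>The rung near \<open>q\<close> must not lie above rung \<open>i\<close>. In the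
    first case rung \<open>i\<close> itself serves; in the second the ladder is truncated at
    \<open>i\<close> before stability is applied.\<close>
  have "\<exists>j\<le>i. d q' (z j) \<le> R + \<delta>"
  proof (cases "q' \<in> B")
    case True
    then have "d p q' + d q' (z i) = d p (z i)" using geodesic_segment_dist[OF B] by blast
    then show ?thesis using i nonneg[OF pM qM(2)] by (intro exI[of _ i]) simp
  next
    case False
    then have "\<exists>j\<le>i. d q' (z j) \<le> R"
      using geodesic_near_ladder[OF ladder_truncate[OF z i(1)] geodesic_segment_sym[OF C]] q' by blast
    then show ?thesis using delta_nonneg by force
  qed
  then obtain j where j: "j \<le> i" "d q' (z j) \<le> R + \<delta>" by blast
  have zjM: "z j \<in> M" "z i \<in> M" using zM j i by auto
  define R2 where "R2 = R + \<delta>"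
  have qj: "d q (z j) \<le> 2 * R2"
    using triangle[OF qM zjM(1)] j q' R_nonneg by (simp add: R2_def)
  have pi: "d p (z i) \<le> R2" "R2 \<ge> 0" using i R_nonneg delta_nonneg by (auto simp: R2_def)
  have "f q \<le> f (z j) + 2 * R2" using height_lipschitz[OF qM(1) zjM(1)] qj by linarith
  moreover have "f (z i) \<le> f p + R2" using height_lipschitz[OF pM zjM(2)] pi by linarith
  moreover have "f (z j) \<le> f (z 0) + j * ln 2 + K" "f (z i) \<ge> f (z 0) + i * ln 2 - K"
  proof -
    have "\<bar>f (z j) - f (z 0) - j * ln 2\<bar> \<le> K" "\<bar>f (z i) - f (z 0) - i * ln 2\<bar> \<le> K"
      using z j i by (auto simp: ladder_def)
    then show "f (z j) \<le> f (z 0) + j * ln 2 + K" "f (z i) \<ge> f (z 0) + i * ln 2 - K"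
      by linarith+
  qed
  ultimately have fq: "f q \<le> f p - (real i - real j) * ln 2 + 2 * K + 3 * R2"
    by (simp add: left_diff_distrib)
  have "d q p \<le> d q (z j) + d (z j) p" "d (z j) p \<le> d (z j) (z i) + d (z i) p"
    using triangle qM zjM pM by auto
  then have "d q p \<le> 3 * R2 + K * (real i - real j)"
    using ladder_dist_le[OF z j(1) i(1)] qj pi commute[of p "z i"] by linarith
  then have "d q p / (2 * K) \<le> (3 * R2 + K * (real i - real j)) / (2 * K)"
    using K_ge_1 by (intro divide_right_mono) auto
  also have "\<dots> = 3 * R2 / (2 * K) + (real i - real j) * (1/2)"
    using K_ge_1 by (simp add: field_simps)
  also have "\<dots> \<le> 3 * R2 + (real i - real j) * ln 2"
  proof (rule add_mono)
    have "3 * R2 / (2 * K) \<le> 3 * R2 / 1" using K_ge_1 pi by (intro divide_left_mono) auto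
    then show "3 * R2 / (2 * K) \<le> 3 * R2" by simp
    show "(real i - real j) * (1/2) \<le> (real i - real j) * ln 2"
      using j ln2_ge_two_thirds by (intro mult_left_mono) auto
  qed
  finally show ?thesis using fq pi by (simp add: R2_def)
qed

text \<open>\<open>p\<close> is \<open>\<delta>\<close>-close to \<open>[x,m]\<close> or to
  \<open>[y,m]\<close>, and this choice precedes \<open>q\<close>: one endpoint serves all
  \<open>q\<close> between it and \<open>p\<close>, so the estimate can be integrated over that
  whole subarc.\<close>

lemma height_growth_along_geodesic:
  assumes z: "ladder N z" "z 0 = x" "z N = m" and w: "ladder N' w" "w 0 = y" "w N' = m"
    and S: "geodesic_segment M d x y S" "p \<in> S"
  shows "(\<forall>q\<in>S. d x q \<le> d x p \<longrightarrow> f q \<le> f p - d q p / (2 * K) + 2 * K + 8 * (R + \<delta>)) \<or>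
         (\<forall>q\<in>S. d y q \<le> d y p \<longrightarrow> f q \<le> f p - d q p / (2 * K) + 2 * K + 8 * (R + \<delta>))"
proof -
  have M: "x \<in> M" "y \<in> M" "m \<in> M" using z w by (auto simp: ladder_def)
  obtain B C where B: "geodesic_segment M d y m B" and C: "geodesic_segment M d m x C"
    using geodesic_exists M by meson
  obtain p' where p': "p' \<in> B \<union> C" "d p p' \<le> \<delta>"
    using thin_triangle[OF M S(1) B C S(2)] .
  have pM: "p \<in> M" "p' \<in> M" using S p' B C geodesic_segment_subset by blast+
  have one_side: "f q \<le> f p - d q p / (2 * K) + 2 * K + 8 * (R + \<delta>)"
    if v: "ladder n v" "v 0 = x'" "v n = m" and x': "x' \<in> M" "y' \<in> M"
      and C': "geodesic_segment M d x' m C'" "p' \<in> C'"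
      and S': "geodesic_segment M d x' y' S" and q: "q \<in> S" "d x' q \<le> d x' p"
    for v n x' y' C' q
  proof -
    obtain l where l: "l \<le> n" "d p' (v l) \<le> R"
      using geodesic_near_ladder[OF v(1)] C' v by blast
    then have "v l \<in> M" using v by (simp add: ladder_def)
    then have pl: "d p (v l) \<le> R + \<delta>" using triangle[OF pM] l p' by fastforce
    obtain T where "geodesic_segment M d x' p T" "q \<in> T"
      using geodesic_initial_segment[OF S' S(2) q x'] by blast
    then show ?thesis using height_growth_near_ladder[OF v(1) l(1) pl pM(1)] v(2) by blast
  qed
  show ?thesis
  proof (cases "p' \<in> B")
    case True
    then show ?thesis
      using one_side[OF w M(2,1) B True geodesic_segment_sym[OF S(1)]] by blast
  next
    case False
    then show ?thesis
      using one_side[OF z M(1,2) geodesic_segment_sym[OF C] _ S(1)] p' by blast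
  qed
qed

end

subsection \<open>Arc length\<close>

lemma edist_nonneg [simp]: "0 \<le> edist n x y"
  by (simp add: edist_def)

lemma edist_refl [simp]: "edist n x x = 0"
  by (simp add: edist_def L2_set_0')

lemma edist_commute: "edist n x y = edist n y x"
  by (simp add: edist_def L2_set_def power2_commute)

lemma edist_triangle: "edist n x z \<le> edist n x y + edist n y z"
  using L2_set_triangle_ineq[of "\<lambda>i. x i - y i" "\<lambda>i. y i - z i" "{..<n}"]
  by (simp add: edist_def)

text \<open>\<open>edist n\<close> reads only the first \<open>n\<close> coordinates, so it
  separates points only where the others are known to vanish.\<close>

lemma edist_eq_0:
  assumes "edist n x y = 0" "x \<in> topspace (Euclidean_space n)" "y \<in> topspace (Euclidean_space n)"
  shows "x = y"
proof
  fix i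
  show "x i = y i"
    using assms by (cases "i < n") (auto simp: edist_def L2_set_eq_0_iff topspace_Euclidean_space)
qed

lemma coordinate_le_edist: "i < n \<Longrightarrow> \<bar>x i - y i\<bar> \<le> edist n x y"
  using member_le_L2_set[of "{..<n}" i "\<lambda>i. \<bar>x i - y i\<bar>"] by (simp add: edist_def L2_set_def)

lemma continuous_on_edist [continuous_intros]:
  assumes "continuous_on S f" "continuous_on S g"
  shows "continuous_on S (\<lambda>t. edist n (f t) (g t))"
proof -
  have "continuous_on S (\<lambda>t. f t i)" "continuous_on S (\<lambda>t. g t i)" for i
    using assms by (auto intro: continuous_on_product_then_coordinatewise)
  then show ?thesis
    unfolding edist_def L2_set_def
    by (intro continuous_on_real_sqrt continuous_on_sum continuous_on_power continuous_on_diff)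
qed

section \<open>Polygonal sums over parameter intervals\<close>

definition partition_sum :: "nat \<Rightarrow> curve \<Rightarrow> nat \<Rightarrow> (nat \<Rightarrow> real) \<Rightarrow> real" where
  "partition_sum n \<gamma> m t = (\<Sum>i<m. edist n (\<gamma> (t i)) (\<gamma> (t (Suc i))))"

text \<open>Neither hitting the endpoints nor strict growth is demanded, so clamping by
  \<open>min\<close> and \<open>max\<close> yields partitions again.\<close>

definition is_partition :: "real \<Rightarrow> real \<Rightarrow> nat \<Rightarrow> (nat \<Rightarrow> real) \<Rightarrow> bool" where
  "is_partition u v m t \<longleftrightarrow> (\<forall>i j. i \<le> j \<longrightarrow> j \<le> m \<longrightarrow> t i \<le> t j) \<and> (\<forall>i\<le>m. u \<le> t i \<and> t i \<le> v)"

text \<open>Sums over a parameter interval of one fixed curve keep additivity free of the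
  reparametrisation in \<open>subcurve\<close>.\<close>

definition partition_sums :: "nat \<Rightarrow> curve \<Rightarrow> real \<Rightarrow> real \<Rightarrow> real set" where
  "partition_sums n \<gamma> u v = {partition_sum n \<gamma> m t | m t. is_partition u v m t}"

lemma polygonal_lengths_eq: "polygonal_lengths n \<gamma> = partition_sums n \<gamma> 0 1"
proof -
  have "is_partition 0 1 m t \<longleftrightarrow> mono_on {..m} t \<and> t ` {..m} \<subseteq> {0..1}" for m t
    unfolding is_partition_def mono_on_def image_subset_iff
    by (simp add: Ball_def) (meson order_trans)
  then show ?thesis
    by (auto simp: polygonal_lengths_def partition_sums_def partition_sum_def)
qed

lemma polygonal_lengths_subcurve:
  assumes "u \<le> v"
  shows "polygonal_lengths n (subcurve u v \<gamma>) = partition_sums n \<gamma> u v"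
proof (intro set_eqI iffI)
  fix x assume "x \<in> polygonal_lengths n (subcurve u v \<gamma>)"
  then obtain m t where t: "is_partition 0 1 m t" "x = partition_sum n (subcurve u v \<gamma>) m t"
    by (auto simp: polygonal_lengths_eq partition_sums_def)
  have "is_partition u v m (\<lambda>i. (v - u) * t i + u)"
    unfolding is_partition_def
  proof (intro conjI allI impI)
    fix i j assume "i \<le> j" "j \<le> m"
    then have "t i \<le> t j" using t by (auto simp: is_partition_def)
    then show "(v - u) * t i + u \<le> (v - u) * t j + u" using assms by (simp add: mult_left_mono)
  next
    fix i assume "i \<le> m"
    then have "0 \<le> t i" "t i \<le> 1" using t by (auto simp: is_partition_def)
    then show "u \<le> (v - u) * t i + u" "(v - u) * t i + u \<le> v"
      using assms mult_left_mono[of "t i" 1 "v - u"] by auto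
  qed
  moreover have "x = partition_sum n \<gamma> m (\<lambda>i. (v - u) * t i + u)"
    using t by (simp add: partition_sum_def subcurve_def)
  ultimately show "x \<in> partition_sums n \<gamma> u v" by (auto simp: partition_sums_def)
next
  fix x assume "x \<in> partition_sums n \<gamma> u v"
  then obtain m t where t: "is_partition u v m t" "x = partition_sum n \<gamma> m t"
    by (auto simp: partition_sums_def)
  \<comment> \<open>For \<open>u = v\<close> all partition points equal \<open>u\<close>, and the
    constant \<open>0\<close> is mapped back to them.\<close>
  define t' where "t' i = (if u < v then (t i - u) / (v - u) else 0)" for i
  have "is_partition 0 1 m t'"
    using t assms by (simp add: is_partition_def t'_def divide_simps)
  moreover have "(v - u) * t' i + u = t i" if "i \<le> m" for i
    using that t assms by (cases "u < v") (auto simp: t'_def is_partition_def intro: antisym)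
  then have "x = partition_sum n (subcurve u v \<gamma>) m t'"
    using t by (simp add: partition_sum_def subcurve_def)
  ultimately show "x \<in> polygonal_lengths n (subcurve u v \<gamma>)"
    by (auto simp: polygonal_lengths_eq partition_sums_def)
qed

lemma partition_sums_nonempty: "u \<le> v \<Longrightarrow> partition_sums n \<gamma> u v \<noteq> {}"
proof -
  assume "u \<le> v"
  then have "is_partition u v 0 (\<lambda>_. u)" by (simp add: is_partition_def)
  then show ?thesis unfolding partition_sums_def by blast
qed

lemma partition_sums_mono:
  "u' \<le> u \<Longrightarrow> v \<le> v' \<Longrightarrow> partition_sums n \<gamma> u v \<subseteq> partition_sums n \<gamma> u' v'"
proof -
  assume "u' \<le> u" "v \<le> v'"
  then have "is_partition u' v' m t" if "is_partition u v m t" for m t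
    using that unfolding is_partition_def by (meson order_trans)
  then show ?thesis unfolding partition_sums_def by blast
qed

lemma edist_in_partition_sums:
  "u \<le> v \<Longrightarrow> edist n (\<gamma> u) (\<gamma> v) \<in> partition_sums n \<gamma> u v"
proof -
  define t where "t i = (if i = 0 then u else v)" for i :: nat
  assume "u \<le> v"
  then have "is_partition u v 1 t" by (auto simp: is_partition_def t_def)
  moreover have "edist n (\<gamma> u) (\<gamma> v) = partition_sum n \<gamma> 1 t" by (simp add: partition_sum_def t_def)
  ultimately show ?thesis unfolding partition_sums_def by blast
qed

text \<open>Clamping replaces the insertion of \<open>v\<close> into the partition: the index set
  stays the same, and only a link crossing \<open>v\<close> is broken, where the triangle inequality
  through \<open>\<gamma> v\<close> applies.\<close>

lemma partition_sum_split:
  assumes "is_partition u w m t"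
  shows "partition_sum n \<gamma> m t \<le>
    partition_sum n \<gamma> m (\<lambda>i. min (t i) v) + partition_sum n \<gamma> m (\<lambda>i. max (t i) v)"
  unfolding partition_sum_def sum.distrib[symmetric]
proof (rule sum_mono)
  fix i assume "i \<in> {..<m}"
  then have "t i \<le> t (Suc i)" using assms by (auto simp: is_partition_def)
  then consider "t (Suc i) \<le> v" | "v \<le> t i" | "t i \<le> v" "v \<le> t (Suc i)" by linarith
  then show "edist n (\<gamma> (t i)) (\<gamma> (t (Suc i))) \<le>
      edist n (\<gamma> (min (t i) v)) (\<gamma> (min (t (Suc i)) v)) +
      edist n (\<gamma> (max (t i) v)) (\<gamma> (max (t (Suc i)) v))"
    using \<open>t i \<le> t (Suc i)\<close> edist_triangle[of n "\<gamma> (t i)" "\<gamma> (t (Suc i))" "\<gamma> v"]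
    by cases (auto simp: min_def max_def)
qed

lemma is_partition_min_max:
  assumes "is_partition u w m t" "u \<le> v" "v \<le> w"
  shows "is_partition u v m (\<lambda>i. min (t i) v)" "is_partition v w m (\<lambda>i. max (t i) v)"
  using assms unfolding is_partition_def
  by (auto simp: min_le_iff_disj le_max_iff_disj) (meson linear order_trans)+

lemma partition_sums_concat:
  assumes "x \<in> partition_sums n \<gamma> u v" "y \<in> partition_sums n \<gamma> v w" "u \<le> v" "v \<le> w"
  shows "\<exists>z\<in>partition_sums n \<gamma> u w. x + y \<le> z"
proof -
  obtain m t where t: "is_partition u v m t" "x = partition_sum n \<gamma> m t"
    using assms by (auto simp: partition_sums_def)
  obtain k s where s: "is_partition v w k s" "y = partition_sum n \<gamma> k s"
    using assms by (auto simp: partition_sums_def)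
  \<comment> \<open>The \<open>m + 1\<close> points of \<open>t\<close> precede those of
    \<open>s\<close>, hence the shift by \<open>Suc m\<close>. The additional link from
    \<open>t m\<close> to \<open>s 0\<close> has nonnegative length, which is why the conclusion is
    an inequality.\<close>
  define r where "r i = (if i \<le> m then t i else s (i - Suc m))" for i
  have "is_partition u w (Suc m + k) r"
    unfolding is_partition_def
  proof (intro conjI allI impI)
    fix i j assume ij: "i \<le> j" "j \<le> Suc m + k"
    consider "j \<le> m" | "i \<le> m" "m < j" | "m < i" by linarith
    then show "r i \<le> r j"
    proof cases
      case 1 then show ?thesis using t ij by (auto simp: r_def is_partition_def)
    next
      case 2
      then have "t i \<le> v" "v \<le> s (j - Suc m)" using t s ij by (auto simp: is_partition_def)
      then show ?thesis using 2 by (simp add: r_def)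
    next
      case 3 then show ?thesis using s ij by (auto simp: r_def is_partition_def)
    qed
  next
    fix i assume "i \<le> Suc m + k"
    then have "i \<le> m \<Longrightarrow> t i \<in> {u..v}" "\<not> i \<le> m \<Longrightarrow> s (i - Suc m) \<in> {v..w}"
      using t s by (auto simp: is_partition_def)
    then show "u \<le> r i" "r i \<le> w" using assms by (auto simp: r_def)
  qed
  moreover have "x + y \<le> partition_sum n \<gamma> (Suc m + k) r"
  proof -
    have "partition_sum n \<gamma> (Suc m + k) r =
      (\<Sum>i<Suc m. edist n (\<gamma> (r i)) (\<gamma> (r (Suc i)))) +
      (\<Sum>i<k. edist n (\<gamma> (r (Suc m + i))) (\<gamma> (r (Suc (Suc m + i)))))"
      unfolding partition_sum_def by (induction k) (simp_all add: add.assoc)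
    also have "(\<Sum>i<k. edist n (\<gamma> (r (Suc m + i))) (\<gamma> (r (Suc (Suc m + i))))) = y"
      using s by (simp add: partition_sum_def r_def)
    also have "(\<Sum>i<Suc m. edist n (\<gamma> (r i)) (\<gamma> (r (Suc i)))) =
        x + edist n (\<gamma> (r m)) (\<gamma> (r (Suc m)))"
      using t by (simp add: partition_sum_def r_def)
    finally show ?thesis by simp
  qed
  ultimately show ?thesis by (auto simp: partition_sums_def)
qed

text \<open>The pieces of a joined path agree with the original paths on \<open>{0..1}\<close>
  only.\<close>

lemma curve_length_cong:
  assumes "\<And>t. t \<in> {0..1} \<Longrightarrow> \<alpha> t = \<beta> t"
  shows "polygonal_lengths n \<alpha> = polygonal_lengths n \<beta>" "curve_length n \<alpha> = curve_length n \<beta>"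
proof -
  have "partition_sum n \<alpha> m t = partition_sum n \<beta> m t" if "is_partition 0 1 m t" for m t
    unfolding partition_sum_def
  proof (rule sum.cong)
    fix i assume "i \<in> {..<m}"
    then have "t i \<in> {0..1}" "t (Suc i) \<in> {0..1}" using that by (auto simp: is_partition_def)
    then show "edist n (\<alpha> (t i)) (\<alpha> (t (Suc i))) = edist n (\<beta> (t i)) (\<beta> (t (Suc i)))"
      using assms by simp
  qed simp
  then show "polygonal_lengths n \<alpha> = polygonal_lengths n \<beta>"
    unfolding polygonal_lengths_eq partition_sums_def by (metis (no_types))
  then show "curve_length n \<alpha> = curve_length n \<beta>" by (simp add: curve_length_def)
qed

lemma line_integral_cong:
  assumes "\<And>t. t \<in> {0..1} \<Longrightarrow> \<alpha> t = \<beta> t"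
  shows "line_integral n \<alpha> f = line_integral n \<beta> f"
proof -
  have "curve_length n (subcurve 0 t \<alpha>) = curve_length n (subcurve 0 t \<beta>)" if "t \<in> {0..1}" for t
    using assms that by (intro curve_length_cong) (auto simp: subcurve_def mult_le_one)
  then have "(\<exists>t\<in>{0..1}. curve_length n (subcurve 0 t \<alpha>) = s \<and> x = \<alpha> t) \<longleftrightarrow>
      (\<exists>t\<in>{0..1}. curve_length n (subcurve 0 t \<beta>) = s \<and> x = \<beta> t)" for s x
    using assms by (intro bex_cong) auto
  then have "arclength_point n \<alpha> s = arclength_point n \<beta> s" for s
    unfolding arclength_point_def by presburger
  then show ?thesis using curve_length_cong(2)[OF assms] by (simp add: line_integral_def)
qed

lemma polygonal_lengths_reversepath_subset:
  "polygonal_lengths n (reversepath \<gamma>) \<subseteq> polygonal_lengths n \<gamma>"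
proof
  fix x assume "x \<in> polygonal_lengths n (reversepath \<gamma>)"
  then obtain m t where t: "is_partition 0 1 m t" "x = partition_sum n (reversepath \<gamma>) m t"
    by (auto simp: polygonal_lengths_eq partition_sums_def)
  define s where "s i = 1 - t (m - i)" for i
  have "is_partition 0 1 m s" using t unfolding is_partition_def s_def by auto
  moreover have "x = partition_sum n \<gamma> m s"
  proof -
    have "partition_sum n \<gamma> m s = (\<Sum>i<m. edist n (\<gamma> (s (m - Suc i))) (\<gamma> (s (Suc (m - Suc i)))))"
      unfolding partition_sum_def by (rule sum.nat_diff_reindex[symmetric])
    also have "\<dots> = x"
      unfolding t partition_sum_def
    proof (rule sum.cong)
      fix i assume "i \<in> {..<m}"
      then have "m - (m - Suc i) = Suc i" "m - Suc (m - Suc i) = i" by auto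
      then show "edist n (\<gamma> (s (m - Suc i))) (\<gamma> (s (Suc (m - Suc i)))) =
          edist n (reversepath \<gamma> (t i)) (reversepath \<gamma> (t (Suc i)))"
        by (simp add: s_def reversepath_def edist_commute)
    qed simp
    finally show ?thesis by simp
  qed
  ultimately show "x \<in> polygonal_lengths n \<gamma>" by (auto simp: polygonal_lengths_eq partition_sums_def)
qed

lemma polygonal_lengths_reversepath:
  "polygonal_lengths n (reversepath \<gamma>) = polygonal_lengths n \<gamma>"
  using polygonal_lengths_reversepath_subset[of n \<gamma>]
    polygonal_lengths_reversepath_subset[of n "reversepath \<gamma>"] by simp

section \<open>Additivity and continuity of arc length\<close>

definition arc_length :: "nat \<Rightarrow> curve \<Rightarrow> real \<Rightarrow> real" where
  "arc_length n \<gamma> t = curve_length n (subcurve 0 t \<gamma>)"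

lemma subcurve_0_1 [simp]: "subcurve 0 1 \<gamma> = \<gamma>"
  by (simp add: subcurve_def)

lemma path_subcurve:
  assumes "path \<gamma>" "0 \<le> u" "u \<le> v" "v \<le> 1"
  shows "path (subcurve u v \<gamma>)" "path_image (subcurve u v \<gamma>) = \<gamma> ` {u..v}"
proof -
  have img: "(\<lambda>t. (v - u) * t + u) ` {0..1} = {u..v}"
    using assms image_affinity_atLeastAtMost[of "v - u" u 0 1] by simp
  have "continuous_on {u..v} \<gamma>"
    using assms by (auto simp: path_def elim: continuous_on_subset)
  then have "continuous_on {0..1} (\<gamma> \<circ> (\<lambda>t. (v - u) * t + u))"
    unfolding img[symmetric] by (intro continuous_on_compose) (auto intro!: continuous_intros)
  then show "path (subcurve u v \<gamma>)" by (simp add: path_def subcurve_def o_def)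
  show "path_image (subcurve u v \<gamma>) = \<gamma> ` {u..v}"
    unfolding path_image_def subcurve_def img[symmetric] image_image ..
qed

context
  fixes n :: nat and \<gamma> :: curve
  assumes rect: "rectifiable n \<gamma>"
begin

lemma bdd_above_partition_sums:
  "0 \<le> u \<Longrightarrow> v \<le> 1 \<Longrightarrow> bdd_above (partition_sums n \<gamma> u v)"
  using rect partition_sums_mono[of 0 u v 1 n \<gamma>]
  by (auto simp: rectifiable_def polygonal_lengths_eq intro: bdd_above_mono)

lemma rectifiable_subcurve:
  "0 \<le> u \<Longrightarrow> u \<le> v \<Longrightarrow> v \<le> 1 \<Longrightarrow> rectifiable n (subcurve u v \<gamma>)"
  using rect bdd_above_partition_sums
  by (simp add: rectifiable_def path_subcurve polygonal_lengths_subcurve)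

text \<open>Clamping gives \<open>\<le>\<close> and concatenation gives \<open>\<ge>\<close>; in the
  latter the two suprema are removed one at a time.\<close>

lemma curve_length_subcurve_add:
  assumes "0 \<le> u" "u \<le> v" "v \<le> w" "w \<le> 1"
  shows "curve_length n (subcurve u w \<gamma>) =
    curve_length n (subcurve u v \<gamma>) + curve_length n (subcurve v w \<gamma>)"
proof -
  let ?P = "partition_sums n \<gamma>"
  have bdd: "bdd_above (?P u w)" "bdd_above (?P u v)" "bdd_above (?P v w)"
    using assms by (auto intro!: bdd_above_partition_sums)
  have ne: "?P u w \<noteq> {}" "?P u v \<noteq> {}" "?P v w \<noteq> {}"
    using assms by (auto intro!: partition_sums_nonempty)
  have "Sup (?P u w) \<le> Sup (?P u v) + Sup (?P v w)"
  proof (rule cSup_least[OF ne(1)])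
    fix x assume "x \<in> ?P u w"
    then obtain m t where t: "is_partition u w m t" "x = partition_sum n \<gamma> m t"
      by (auto simp: partition_sums_def)
    have "partition_sum n \<gamma> m (\<lambda>i. min (t i) v) \<in> ?P u v"
      "partition_sum n \<gamma> m (\<lambda>i. max (t i) v) \<in> ?P v w"
      using is_partition_min_max[OF t(1) assms(2,3)] by (auto simp: partition_sums_def)
    from cSup_upper[OF this(1) bdd(2)] cSup_upper[OF this(2) bdd(3)]
    show "x \<le> Sup (?P u v) + Sup (?P v w)"
      using partition_sum_split[OF t(1), of n \<gamma> v] t(2) by linarith
  qed
  moreover have "Sup (?P u v) \<le> Sup (?P u w) - Sup (?P v w)"
  proof (rule cSup_least[OF ne(2)])
    fix x assume x: "x \<in> ?P u v"
    have "Sup (?P v w) \<le> Sup (?P u w) - x"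
    proof (rule cSup_least[OF ne(3)])
      fix y assume "y \<in> ?P v w"
      then obtain z where z: "z \<in> ?P u w" "x + y \<le> z"
        using partition_sums_concat[OF x _ assms(2,3)] by blast
      then show "y \<le> Sup (?P u w) - x"
        using cSup_upper[OF z(1) bdd(1)] by linarith
    qed
    then show "x \<le> Sup (?P u w) - Sup (?P v w)" by simp
  qed
  ultimately show ?thesis
    using assms by (simp add: curve_length_def polygonal_lengths_subcurve)
qed

lemma edist_le_curve_length_subcurve:
  assumes "0 \<le> u" "u \<le> v" "v \<le> 1"
  shows "edist n (\<gamma> u) (\<gamma> v) \<le> curve_length n (subcurve u v \<gamma>)"
  using assms edist_in_partition_sums bdd_above_partition_sums
  by (simp add: curve_length_def polygonal_lengths_subcurve cSup_upper)

lemma curve_length_subcurve: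
  assumes "0 \<le> u" "u \<le> v" "v \<le> 1"
  shows "curve_length n (subcurve u v \<gamma>) = arc_length n \<gamma> v - arc_length n \<gamma> u"
  using curve_length_subcurve_add[of 0 u v] assms by (simp add: arc_length_def)

lemma edist_le_arc_length:
  assumes "0 \<le> u" "u \<le> v" "v \<le> 1"
  shows "edist n (\<gamma> u) (\<gamma> v) \<le> arc_length n \<gamma> v - arc_length n \<gamma> u"
  using edist_le_curve_length_subcurve[OF assms] curve_length_subcurve[OF assms] by simp

lemma arc_length_mono:
  assumes "0 \<le> u" "u \<le> v" "v \<le> 1"
  shows "arc_length n \<gamma> u \<le> arc_length n \<gamma> v"
  using edist_le_arc_length[OF assms] edist_nonneg[of n "\<gamma> u" "\<gamma> v"] by linarith

lemma arc_length_0 [simp]: "arc_length n \<gamma> 0 = 0"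
  using curve_length_subcurve_add[of 0 0 0] by (simp add: arc_length_def)

lemma arc_length_1 [simp]: "arc_length n \<gamma> 1 = curve_length n \<gamma>"
  by (simp add: arc_length_def)

text \<open>The arc length is a uniform limit of the lengths of inscribed polygons truncated at a variable
  parameter, for partitions that nearly realise the total length.\<close>

lemma continuous_on_arc_length: "continuous_on {0..1} (arc_length n \<gamma>)"
proof -
  have ne: "partition_sums n \<gamma> 0 1 \<noteq> {}" by (simp add: partition_sums_nonempty)
  have "\<exists>m t. is_partition 0 1 m t \<and> curve_length n \<gamma> - inverse (real (Suc k)) < partition_sum n \<gamma> m t" for k
  proof -
    have "curve_length n \<gamma> - inverse (real (Suc k)) < Sup (partition_sums n \<gamma> 0 1)"
      by (simp add: curve_length_def polygonal_lengths_eq)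
    from less_cSupD[OF ne this] show ?thesis unfolding partition_sums_def by blast
  qed
  then obtain m t where t: "\<And>k. is_partition 0 1 (m k) (t k)"
    "\<And>k. curve_length n \<gamma> - inverse (real (Suc k)) < partition_sum n \<gamma> (m k) (t k)"
    by metis
  \<comment> \<open>The defects of the parts left and right of \<open>\<tau>\<close> are nonnegative
    and add up to at most the total defect, so the left one is below \<open>inverse (Suc k)\<close>
    uniformly in \<open>\<tau>\<close>.\<close>
  define F where "F k \<tau> = partition_sum n \<gamma> (m k) (\<lambda>i. min (t k i) \<tau>)" for k \<tau>
  have F: "F k \<tau> \<le> arc_length n \<gamma> \<tau>" "arc_length n \<gamma> \<tau> < F k \<tau> + inverse (real (Suc k))"
    if \<tau>: "\<tau> \<in> {0..1}" for k \<tau>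
  proof -
    have "F k \<tau> \<in> partition_sums n \<gamma> 0 \<tau>"
      using is_partition_min_max(1)[OF t(1)[of k], of \<tau>] \<tau> by (auto simp: F_def partition_sums_def)
    then show "F k \<tau> \<le> arc_length n \<gamma> \<tau>"
      using \<tau> bdd_above_partition_sums[of 0 \<tau>]
      by (auto simp: arc_length_def curve_length_def polygonal_lengths_subcurve intro: cSup_upper)
    have "partition_sum n \<gamma> (m k) (\<lambda>i. max (t k i) \<tau>) \<in> partition_sums n \<gamma> \<tau> 1"
      using is_partition_min_max(2)[OF t(1)[of k], of \<tau>] \<tau> by (auto simp: partition_sums_def)
    then have "partition_sum n \<gamma> (m k) (\<lambda>i. max (t k i) \<tau>) \<le> curve_length n (subcurve \<tau> 1 \<gamma>)"
      using \<tau> bdd_above_partition_sums[of \<tau> 1]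
      by (auto simp: curve_length_def polygonal_lengths_subcurve intro: cSup_upper)
    also have "\<dots> = curve_length n \<gamma> - arc_length n \<gamma> \<tau>"
      using curve_length_subcurve[of \<tau> 1] \<tau> by simp
    finally show "arc_length n \<gamma> \<tau> < F k \<tau> + inverse (real (Suc k))"
      using partition_sum_split[OF t(1)[of k], of n \<gamma> \<tau>] t(2)[of k] unfolding F_def by linarith
  qed
  have "uniform_limit {0..1} F (arc_length n \<gamma>) sequentially"
  proof (rule uniform_limitI)
    fix e :: real assume "e > 0"
    then have "\<forall>\<^sub>F k in sequentially. inverse (real (Suc k)) < e"
      by (rule order_tendstoD(2)[OF LIMSEQ_inverse_real_of_nat])
    then show "\<forall>\<^sub>F k in sequentially. \<forall>\<tau>\<in>{0..1}. dist (F k \<tau>) (arc_length n \<gamma> \<tau>) < e"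
    proof eventually_elim
      case (elim k)
      have "\<bar>F k \<tau> - arc_length n \<gamma> \<tau>\<bar> < e" if "\<tau> \<in> {0..1}" for \<tau>
        using F[OF that, of k] elim by linarith
      then show ?case by (simp add: dist_real_def)
    qed
  qed
  moreover have "continuous_on {0..1} (F k)" for k
  proof -
    have tk: "t k i \<in> {0..1}" if "i \<le> m k" for i using t(1)[of k] that by (auto simp: is_partition_def)
    have "continuous_on {0..1} (\<lambda>\<tau>. \<gamma> (min (t k i) \<tau>))" if "i \<le> m k" for i
    proof (rule continuous_on_compose2[of "{0..1}" \<gamma>])
      show "continuous_on {0..1} \<gamma>" using rect by (simp add: rectifiable_def path_def)
      show "continuous_on {0..1} (\<lambda>\<tau>. min (t k i) \<tau>)" by (intro continuous_intros)
      show "min (t k i) ` {0..1} \<subseteq> {0..1}" using tk[OF that] by (auto simp: min_def)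
    qed
    then show ?thesis
      unfolding F_def partition_sum_def
      by (intro continuous_on_sum continuous_on_edist) (simp_all add: Suc_leI less_imp_le)
  qed
  ultimately show ?thesis
    using Uniform_Limit.uniform_limit_theorem[of "{0..1}" F sequentially] by simp
qed

lemma arc_length_surj:
  assumes "s \<in> {0..curve_length n \<gamma>}"
  obtains t where "t \<in> {0..1}" "arc_length n \<gamma> t = s"
  using IVT'[of "arc_length n \<gamma>" 0 s 1] continuous_on_arc_length assms by auto

lemma arc_length_subcurve:
  assumes "0 \<le> u" "u \<le> v" "v \<le> 1" "t \<in> {0..1}"
  shows "arc_length n (subcurve u v \<gamma>) t = arc_length n \<gamma> ((v - u) * t + u) - arc_length n \<gamma> u"
proof -
  have "(v - u) * t \<le> (v - u) * 1" "0 \<le> (v - u) * t" using assms by (auto intro!: mult_left_mono mult_left_le)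
  moreover have "subcurve 0 t (subcurve u v \<gamma>) = subcurve u ((v - u) * t + u) \<gamma>"
    by (simp add: subcurve_def algebra_simps)
  ultimately show ?thesis
    using curve_length_subcurve[of u "(v - u) * t + u"] assms by (simp add: arc_length_def)
qed

lemma arc_length_reversepath:
  assumes "t \<in> {0..1}"
  shows "arc_length n (reversepath \<gamma>) t = curve_length n \<gamma> - arc_length n \<gamma> (1 - t)"
proof -
  have "subcurve 0 t (reversepath \<gamma>) = reversepath (subcurve (1 - t) 1 \<gamma>)"
    by (simp add: subcurve_def reversepath_def algebra_simps)
  then show ?thesis
    using curve_length_subcurve[of "1 - t" 1] assms
    by (simp add: arc_length_def curve_length_def polygonal_lengths_reversepath)
qed

lemma rectifiable_reversepath: "rectifiable n (reversepath \<gamma>)"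
  using rect by (simp add: rectifiable_def polygonal_lengths_reversepath)

section \<open>Arc length parametrisation and line integrals\<close>

text \<open>Discharges the definite description: a subcurve of length 0 has endpoints at distance 0,
  so equal arc lengths mean equal points.\<close>

lemma arclength_point_arc_length:
  assumes "path_image \<gamma> \<subseteq> topspace (Euclidean_space n)" "t \<in> {0..1}"
  shows "arclength_point n \<gamma> (arc_length n \<gamma> t) = \<gamma> t"
  unfolding arclength_point_def arc_length_def[symmetric]
proof (rule the_equality)
  fix x assume "\<exists>t'\<in>{0..1}. arc_length n \<gamma> t' = arc_length n \<gamma> t \<and> x = \<gamma> t'"
  then obtain t' where t': "t' \<in> {0..1}" "arc_length n \<gamma> t' = arc_length n \<gamma> t" "x = \<gamma> t'" by blast
  have "edist n (\<gamma> t') (\<gamma> t) \<le> 0"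
    using edist_le_arc_length[of t t'] edist_le_arc_length[of t' t] t' assms(2)
    by (cases "t \<le> t'") (auto simp: edist_commute)
  then have "edist n (\<gamma> t') (\<gamma> t) = 0" using edist_nonneg[of n "\<gamma> t'" "\<gamma> t"] by linarith
  moreover have "\<gamma> t' \<in> topspace (Euclidean_space n)" "\<gamma> t \<in> topspace (Euclidean_space n)"
    using assms t'(1) unfolding path_image_def by blast+
  ultimately show "x = \<gamma> t" using edist_eq_0 t'(3) by blast
qed (use assms in auto)

end

lemma edist_arclength_point_le:
  assumes rect: "rectifiable n \<gamma>" and E: "path_image \<gamma> \<subseteq> topspace (Euclidean_space n)"
    and s: "s \<in> {0..curve_length n \<gamma>}" "s' \<in> {0..curve_length n \<gamma>}"
  shows "edist n (arclength_point n \<gamma> s) (arclength_point n \<gamma> s') \<le> \<bar>s - s'\<bar>"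
proof -
  obtain t where t: "t \<in> {0..1}" "arc_length n \<gamma> t = s" using arc_length_surj[OF rect s(1)] .
  obtain t' where t': "t' \<in> {0..1}" "arc_length n \<gamma> t' = s'" using arc_length_surj[OF rect s(2)] .
  have "edist n (\<gamma> t) (\<gamma> t') \<le> \<bar>s - s'\<bar>"
    using edist_le_arc_length[OF rect, of t t'] edist_le_arc_length[OF rect, of t' t] t t'
    by (cases "t \<le> t'") (auto simp: edist_commute)
  then show ?thesis
    using arclength_point_arc_length[OF rect E t(1)] arclength_point_arc_length[OF rect E t'(1)] t t'
    by simp
qed

lemma arclength_point_in_path_image:
  assumes "rectifiable n \<gamma>" "path_image \<gamma> \<subseteq> topspace (Euclidean_space n)" "s \<in> {0..curve_length n \<gamma>}"
  shows "arclength_point n \<gamma> s \<in> path_image \<gamma>"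
proof -
  obtain t where t: "t \<in> {0..1}" "arc_length n \<gamma> t = s" using arc_length_surj[OF assms(1,3)] .
  then show ?thesis
    using arclength_point_arc_length[OF assms(1,2) t(1)] by (simp add: path_image_def)
qed

text \<open>Integrals over subcurves become integrals of one integrand over subintervals, so
  additivity and the fundamental theorem of calculus apply.\<close>

lemma line_integral_subcurve:
  assumes rect: "rectifiable n \<gamma>" and E: "path_image \<gamma> \<subseteq> topspace (Euclidean_space n)"
    and uv: "0 \<le> u" "u \<le> v" "v \<le> 1"
  shows "line_integral n (subcurve u v \<gamma>) f =
    integral {arc_length n \<gamma> u..arc_length n \<gamma> v} (\<lambda>s. f (arclength_point n \<gamma> s))"
proof -
  let ?\<sigma> = "subcurve u v \<gamma>" and ?L = "arc_length n \<gamma>"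
  have rs: "rectifiable n ?\<sigma>" using rectifiable_subcurve[OF rect] uv by blast
  have "path \<gamma>" using rect by (simp add: rectifiable_def)
  then have Es: "path_image ?\<sigma> \<subseteq> topspace (Euclidean_space n)"
    using E uv by (subst path_subcurve) (auto simp: path_image_def)
  have "arclength_point n ?\<sigma> s = arclength_point n \<gamma> (s + ?L u)" if "s \<in> {0..?L v - ?L u}" for s
  proof -
    have "s \<in> {0..curve_length n ?\<sigma>}" using that curve_length_subcurve[OF rect uv] by simp
    then obtain t where t: "t \<in> {0..1}" "arc_length n ?\<sigma> t = s" by (rule arc_length_surj[OF rs])
    have "(v - u) * t \<le> (v - u) * 1" "0 \<le> (v - u) * t" using t uv by (auto intro!: mult_left_mono mult_left_le)
    then have "(v - u) * t + u \<in> {0..1}" using uv by auto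
    then have "arclength_point n \<gamma> (?L ((v - u) * t + u)) = ?\<sigma> t"
      using arclength_point_arc_length[OF rect E] by (simp add: subcurve_def)
    moreover have "?L ((v - u) * t + u) = s + ?L u"
      using arc_length_subcurve[OF rect uv t(1)] t by simp
    ultimately show ?thesis using arclength_point_arc_length[OF rs Es t(1)] t by simp
  qed
  then have "line_integral n ?\<sigma> f =
      integral {0..?L v - ?L u} (\<lambda>s. f (arclength_point n \<gamma> (s + ?L u)))"
    unfolding line_integral_def curve_length_subcurve[OF rect uv]
    by (intro integral_cong) auto
  also have "\<dots> = integral {?L u..?L v} (\<lambda>s. f (arclength_point n \<gamma> s))"
    using integral_shift_real_ivl[of "?L u" "?L u" "?L v" "\<lambda>s. f (arclength_point n \<gamma> s)"] by simp
  finally show ?thesis .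
qed

lemma curve_length_reversepath: "curve_length n (reversepath \<gamma>) = curve_length n \<gamma>"
  by (simp add: curve_length_def polygonal_lengths_reversepath)

lemma arclength_point_reversepath:
  assumes rect: "rectifiable n \<gamma>" and E: "path_image \<gamma> \<subseteq> topspace (Euclidean_space n)"
    and s: "s \<in> {0..curve_length n \<gamma>}"
  shows "arclength_point n (reversepath \<gamma>) s = arclength_point n \<gamma> (curve_length n \<gamma> - s)"
proof -
  have rr: "rectifiable n (reversepath \<gamma>)" using rectifiable_reversepath[OF rect] .
  have "s \<in> {0..curve_length n (reversepath \<gamma>)}" using s by (simp add: curve_length_reversepath)
  then obtain t where t: "t \<in> {0..1}" "arc_length n (reversepath \<gamma>) t = s"
    by (rule arc_length_surj[OF rr])
  have "arclength_point n \<gamma> (arc_length n \<gamma> (1 - t)) = reversepath \<gamma> t"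
    using arclength_point_arc_length[OF rect E, of "1 - t"] t by (simp add: reversepath_def)
  moreover have "arclength_point n (reversepath \<gamma>) s = reversepath \<gamma> t"
    using arclength_point_arc_length[OF rr _ t(1)] E t by simp
  moreover have "arc_length n \<gamma> (1 - t) = curve_length n \<gamma> - s"
    using arc_length_reversepath[OF rect t(1)] t by simp
  ultimately show ?thesis by simp
qed

lemma line_integral_reversepath:
  assumes rect: "rectifiable n \<gamma>" and E: "path_image \<gamma> \<subseteq> topspace (Euclidean_space n)"
  shows "line_integral n (reversepath \<gamma>) f = line_integral n \<gamma> f"
proof -
  let ?l = "curve_length n \<gamma>"
  have "line_integral n (reversepath \<gamma>) f =
      integral {0..?l} (\<lambda>s. f (arclength_point n \<gamma> (- (s - ?l))))"
    unfolding line_integral_def curve_length_reversepath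
    by (intro integral_cong) (simp add: arclength_point_reversepath[OF rect E])
  also have "\<dots> = integral {-?l..0} (\<lambda>s. f (arclength_point n \<gamma> (- s)))"
    using integral_shift_real_ivl[of "-?l" "-?l" 0 "\<lambda>s. f (arclength_point n \<gamma> (- s))"] by simp
  also have "\<dots> = line_integral n \<gamma> f"
    using Henstock_Kurzweil_Integration.integral_reflect_real[of ?l 0 "\<lambda>s. f (arclength_point n \<gamma> s)"]
    by (simp add: line_integral_def)
  finally show ?thesis .
qed

lemma subcurve_joinpaths:
  assumes "pathfinish \<alpha> = pathstart \<beta>" "t \<in> {0..1}"
  shows "subcurve 0 (1/2) (\<alpha> +++ \<beta>) t = \<alpha> t" "subcurve (1/2) 1 (\<alpha> +++ \<beta>) t = \<beta> t"
proof -
  show "subcurve 0 (1/2) (\<alpha> +++ \<beta>) t = \<alpha> t"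
    using assms by (simp add: subcurve_def joinpaths_def)
  show "subcurve (1/2) 1 (\<alpha> +++ \<beta>) t = \<beta> t"
  \<comment> \<open>At parameter \<open>1/2\<close> a join still takes the end of
    \<open>\<alpha>\<close>, so \<open>t = 0\<close> needs the matching endpoints.\<close>
  proof (cases "t = 0")
    case True
    then show ?thesis using assms(1) by (simp add: subcurve_def joinpaths_def pathfinish_def pathstart_def)
  next
    case False
    then have "\<not> t \<le> 0" using assms by simp
    then show ?thesis by (simp add: subcurve_def joinpaths_def)
  qed
qed

lemma rectifiable_joinpaths:
  assumes "rectifiable n \<alpha>" "rectifiable n \<beta>" "pathfinish \<alpha> = pathstart \<beta>"
  shows "rectifiable n (\<alpha> +++ \<beta>)"
proof -
  let ?\<gamma> = "\<alpha> +++ \<beta>"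
  have eq: "partition_sums n ?\<gamma> 0 (1/2) = polygonal_lengths n \<alpha>"
      "partition_sums n ?\<gamma> (1/2) 1 = polygonal_lengths n \<beta>"
    using curve_length_cong(1)[of "subcurve 0 (1/2) ?\<gamma>" \<alpha> n]
      curve_length_cong(1)[of "subcurve (1/2) 1 ?\<gamma>" \<beta> n] subcurve_joinpaths[OF assms(3)]
    by (simp_all add: polygonal_lengths_subcurve)
  obtain A B where A: "\<And>x. x \<in> polygonal_lengths n \<alpha> \<Longrightarrow> x \<le> A"
    and B: "\<And>x. x \<in> polygonal_lengths n \<beta> \<Longrightarrow> x \<le> B"
    using assms by (auto simp: rectifiable_def bdd_above_def)
  have "x \<le> A + B" if "x \<in> polygonal_lengths n ?\<gamma>" for x
  proof -
    obtain m t where t: "is_partition 0 1 m t" "x = partition_sum n ?\<gamma> m t"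
      using \<open>x \<in> polygonal_lengths n ?\<gamma>\<close> by (auto simp: polygonal_lengths_eq partition_sums_def)
    have "partition_sum n ?\<gamma> m (\<lambda>i. min (t i) (1/2)) \<in> polygonal_lengths n \<alpha>"
      "partition_sum n ?\<gamma> m (\<lambda>i. max (t i) (1/2)) \<in> polygonal_lengths n \<beta>"
      using is_partition_min_max[OF t(1), of "1/2"] unfolding eq[symmetric]
      by (auto simp: partition_sums_def)
    then show ?thesis
      using A B partition_sum_split[OF t(1), of n ?\<gamma> "1/2"] t(2) by (meson add_mono order_trans)
  qed
  then show ?thesis
    using assms by (auto simp: rectifiable_def bdd_above_def)
qed

subsection \<open>The quasihyperbolic metric\<close>

text \<open>The comparison integral for both directions: a lower bound on the quasihyperbolic length
  of any curve, and an upper bound along cone arcs.\<close>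

lemma has_integral_inverse_affine:
  fixes c :: real
  assumes "s \<le> t" "0 < c + s"
  shows "((\<lambda>r. 1 / (c + r)) has_integral (ln (c + t) - ln (c + s))) {s..t}"
  using assms
  by (intro fundamental_theorem_of_calculus)
    (auto intro!: derivative_eq_intros simp: has_real_derivative_iff_has_vector_derivative[symmetric])

text \<open>The function \<open>\<epsilon> \<kappa> P exp (\<epsilon> (G - c) / \<kappa>)\<close> has derivative at least \<open>1\<close>.\<close>

lemma interval_length_le_exp_decay:
  fixes G b :: "real \<Rightarrow> real" and \<epsilon> \<kappa> P c :: real
  assumes "s \<le> t" "\<kappa> > 0" "P > 0" "\<bar>\<epsilon>\<bar> = 1"
    and G: "\<And>r. r \<in> {s..t} \<Longrightarrow> (G has_real_derivative 1 / b r) (at r within {s..t})"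
    and b: "\<And>r. r \<in> {s..t} \<Longrightarrow> 0 < b r"
    and decay: "\<And>r. r \<in> {s..t} \<Longrightarrow> b r \<le> P * exp (\<epsilon> * (G r - c) / \<kappa>)"
    and neg: "\<And>r. r \<in> {s..t} \<Longrightarrow> \<epsilon> * (G r - c) \<le> 0"
  shows "t - s \<le> \<kappa> * P"
proof -
  \<comment> \<open>The sign \<open>\<epsilon>\<close> tells the side of the reference point:
    \<open>1\<close> before it, \<open>-1\<close> after it. As
    \<open>\<epsilon> * \<epsilon> = 1\<close>, \<open>\<Phi>\<close> increases on either side, with
    values between \<open>0\<close> and \<open>\<epsilon> * \<kappa> * P\<close>.\<close>
  define \<Phi> where "\<Phi> r = \<epsilon> * \<kappa> * P * exp (\<epsilon> * (G r - c) / \<kappa>)" for r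
  have e2: "\<epsilon> * \<epsilon> = 1" using assms(4) by (metis abs_mult_self_eq mult_1)
  have D: "(\<Phi> has_real_derivative P * exp (\<epsilon> * (G r - c) / \<kappa>) / b r) (at r within {s..t})"
    if "r \<in> {s..t}" for r
  proof -
    have "((\<lambda>r. G r - c) has_real_derivative 1 / b r) (at r within {s..t})"
      using DERIV_diff[OF G[OF that] DERIV_const[of c]] by simp
    then have "((\<lambda>r. \<epsilon> * (G r - c) / \<kappa>) has_real_derivative \<epsilon> * (1 / b r) / \<kappa>) (at r within {s..t})"
      by (intro DERIV_cdivide DERIV_cmult)
    from DERIV_cmult[OF DERIV_chain2[OF DERIV_exp this], of "\<epsilon> * \<kappa> * P"]
    have "(\<Phi> has_real_derivative (\<epsilon> * \<epsilon>) * (P * exp (\<epsilon> * (G r - c) / \<kappa>) / b r)) (at r within {s..t})"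
      using \<open>\<kappa> > 0\<close> by (simp add: \<Phi>_def[abs_def] mult_ac)
    then show ?thesis by (simp add: e2)
  qed
  have I: "((\<lambda>r. P * exp (\<epsilon> * (G r - c) / \<kappa>) / b r) has_integral (\<Phi> t - \<Phi> s)) {s..t}"
    using D assms(1)
    by (intro fundamental_theorem_of_calculus)
      (auto simp: has_real_derivative_iff_has_vector_derivative[symmetric])
  have "((\<lambda>r. 1::real) has_integral (t - s)) {s..t}"
    using has_integral_const_real[of "1::real" s t] assms(1) by simp
  from has_integral_le[OF this I] have "t - s \<le> \<Phi> t - \<Phi> s"
    using decay b by (simp add: le_divide_eq)
  also have "\<dots> \<le> \<kappa> * P"
  proof -
    define A where "A r = \<kappa> * P * exp (\<epsilon> * (G r - c) / \<kappa>)" for r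
    have A: "0 \<le> A r" "A r \<le> \<kappa> * P" if "r \<in> {s..t}" for r
      using neg[OF that] assms(2,3) by (auto simp: A_def divide_le_0_iff intro!: mult_left_le)
    have "\<Phi> r = \<epsilon> * A r" for r by (simp add: \<Phi>_def A_def)
    moreover have "\<epsilon> = 1 \<or> \<epsilon> = -1" using assms(4) by linarith
    ultimately show ?thesis using A[of s] A[of t] assms(1) by auto
  qed
  finally show ?thesis .
qed

section \<open>Boundary distance\<close>

locale subdomain =
  fixes n :: nat and D :: "point set"
  assumes proper: "proper_subdomain n D"
begin

abbreviation "E \<equiv> Euclidean_space n"
abbreviation "bd \<equiv> bdist n D"
abbreviation "k \<equiv> qh_dist n D"

lemma D_subset: "D \<subseteq> topspace E"
  using proper openin_subset by (auto simp: proper_subdomain_def)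

text \<open>The infimum defining \<open>bdist\<close> is meaningful over a nonempty set only. With
  empty frontier \<open>D\<close> would be clopen in a connected space.\<close>

lemma frontier_nonempty: "E frontier_of D \<noteq> {}"
proof
  assume "E frontier_of D = {}"
  then have "closedin E D" "openin E D"
    using frontier_of_eq_empty[OF D_subset] by auto
  then have "D = {} \<or> D = topspace E"
    using connected_Euclidean_space[of n] by (auto simp: connected_space_clopen_in)
  then show False using proper by (auto simp: proper_subdomain_def)
qed

lemma bdd_below_edist: "bdd_below ((\<lambda>w. edist n z w) ` A)"
  by (rule bdd_belowI[of _ 0]) auto

lemma bdist_le_add: "bd z \<le> bd w + edist n z w"
proof -
  have "bd z - edist n z w \<le> bd w"
    unfolding bdist_def[of n D w]
  proof (rule cINF_greatest[OF frontier_nonempty])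
    fix v assume "v \<in> E frontier_of D"
    then have "bd z \<le> edist n z v" unfolding bdist_def by (intro cINF_lower bdd_below_edist)
    then show "bd z - edist n z w \<le> edist n w v" using edist_triangle[of n z v w] by linarith
  qed
  then show ?thesis by simp
qed

lemma bdist_lipschitz: "\<bar>bd z - bd w\<bar> \<le> edist n z w"
  using bdist_le_add[of z w] bdist_le_add[of w z] edist_commute[of n z w] by linarith

text \<open>Translates openness in a subspace of the infinite product into \<open>edist\<close>
  balls: a basic box constrains coordinates separately, and those from \<open>n\<close> on are all
  0, so finitely many radii decide.\<close>

lemma ball_subset:
  assumes "z \<in> D"
  obtains e where "e > 0" "\<And>w. w \<in> topspace E \<Longrightarrow> edist n z w < e \<Longrightarrow> w \<in> D"
proof -
  have "openin E D" using proper by (simp add: proper_subdomain_def)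
  then obtain T where T: "openin (product_topology (\<lambda>i::nat. euclideanreal) UNIV) T"
    "D = T \<inter> {x. \<forall>i\<ge>n. x i = 0}"
    by (auto simp: Euclidean_space_def openin_subtopology)
  then have "z \<in> T" using assms by blast
  from product_topology_open_contains_basis[OF T(1) this]
  obtain X where X: "z \<in> PiE UNIV X" "\<And>i. open (X i)" "PiE UNIV X \<subseteq> T" by auto
  have "\<forall>i. \<exists>e>0. \<forall>y. \<bar>z i - y\<bar> < e \<longrightarrow> y \<in> X i"
  proof
    fix i
    have "z i \<in> X i" using X by auto
    then show "\<exists>e>0. \<forall>y. \<bar>z i - y\<bar> < e \<longrightarrow> y \<in> X i"
      using X(2)[of i] unfolding open_dist dist_real_def by (metis abs_minus_commute)
  qed
  then obtain e where e: "\<And>i. e i > 0" "\<And>i y. \<bar>z i - y\<bar> < e i \<Longrightarrow> y \<in> X i" by metis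
  \<comment> \<open>The inserted \<open>1\<close> keeps the set nonempty for
    \<open>n = 0\<close>.\<close>
  define \<epsilon> where "\<epsilon> = Min (insert 1 (e ` {..<n}))"
  have "\<epsilon> > 0" unfolding \<epsilon>_def using e(1) by (subst Min_gr_iff) auto
  moreover have "w \<in> D" if "w \<in> topspace E" "edist n z w < \<epsilon>" for w
  proof -
    have "w i \<in> X i" for i
    proof (cases "i < n")
      case True
      then have "\<epsilon> \<le> e i" unfolding \<epsilon>_def by (intro Min_le) auto
      then show ?thesis using e(2)[of i "w i"] coordinate_le_edist[OF True, of z w] that by linarith
    next
      case False
      then have "w i = z i" using that assms D_subset by (auto simp: topspace_Euclidean_space)
      then show ?thesis using e(2)[of i "w i"] e(1)[of i] by simp
    qed
    then have "w \<in> T" using X(3) by auto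
    then show ?thesis using T(2) that by (simp add: topspace_Euclidean_space)
  qed
  ultimately show thesis using that by blast
qed

lemma bdist_pos:
  assumes "z \<in> D"
  shows "0 < bd z"
proof -
  obtain e where e: "e > 0" "\<And>w. w \<in> topspace E \<Longrightarrow> edist n z w < e \<Longrightarrow> w \<in> D"
    using ball_subset[OF assms] by blast
  have op: "openin E D" using proper by (simp add: proper_subdomain_def)
  have "e \<le> bd z"
    unfolding bdist_def
  proof (rule cINF_greatest[OF frontier_nonempty])
    fix w assume w: "w \<in> E frontier_of D"
    then have "w \<notin> D" using frontier_of_openin[OF op] by blast
    moreover have "w \<in> topspace E" using subsetD[OF frontier_of_subset_topspace w] .
    ultimately show "e \<le> edist n z w" using e(2) by force
  qed
  then show ?thesis using e by linarith
qed

lemma continuous_on_bdist: "continuous_on UNIV bd"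
  unfolding continuous_on_def
proof
  fix z :: point
  have "continuous_on UNIV (\<lambda>w. edist n w z)" by (intro continuous_on_edist continuous_intros)
  then have "((\<lambda>w. edist n w z) \<longlongrightarrow> edist n z z) (at z)"
    unfolding continuous_on_def by (rule bspec) simp
  then have "((\<lambda>w. edist n w z) \<longlongrightarrow> 0) (at z)" by simp
  moreover have "\<forall>\<^sub>F w in at z. norm (bd w - bd z) \<le> edist n w z" by (simp add: bdist_lipschitz)
  ultimately have "((\<lambda>w. bd w - bd z) \<longlongrightarrow> 0) (at z)"
    by (rule Lim_null_comparison[rotated])
  then show "(bd \<longlongrightarrow> bd z) (at z)" using LIM_zero_iff by blast
qed

text \<open>A closed part of a product of compact intervals. Positivity of \<open>c\<close> keeps it
  off the frontier, where \<open>bd\<close> is at most 0, so a limit of points of \<open>D\<close>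
  stays in \<open>D\<close>.\<close>

lemma compact_truncation:
  assumes "c > 0"
  shows "compact {w \<in> D. c \<le> bd w \<and> edist n x w \<le> r}"
proof -
  let ?B = "\<lambda>i. if i < n then {x i - r..x i + r} else {0::real}"
  have op: "openin E D" using proper by (simp add: proper_subdomain_def)
  have "compactin (product_topology (\<lambda>i. euclideanreal) UNIV) (PiE UNIV ?B)"
    by (subst compactin_PiE) auto
  then have box: "compact (PiE UNIV ?B)" by (simp add: euclidean_product_topology)
  have cl: "closed (E closure_of D)" by (rule closedin_Euclidean_imp_closed[of n]) simp
  have "closed {w. c \<le> bd w}"
    using continuous_on_bdist by (intro closed_Collect_le continuous_intros) auto
  moreover have "closed {w. edist n x w \<le> r}"
    by (intro closed_Collect_le continuous_on_edist continuous_intros)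
  ultimately have "compact (PiE UNIV ?B \<inter> (E closure_of D \<inter> ({w. c \<le> bd w} \<inter> {w. edist n x w \<le> r})))"
    using box cl by (intro compact_Int_closed closed_Int)
  moreover have "PiE UNIV ?B \<inter> (E closure_of D \<inter> ({w. c \<le> bd w} \<inter> {w. edist n x w \<le> r})) =
      {w \<in> D. c \<le> bd w \<and> edist n x w \<le> r}" (is "?L = ?R")
  proof
    show "?L \<subseteq> ?R"
    proof
      fix w assume w: "w \<in> ?L"
      have "w \<notin> E frontier_of D"
      proof
        assume "w \<in> E frontier_of D"
        then have "bd w \<le> edist n w w" unfolding bdist_def by (intro cINF_lower bdd_below_edist)
        then show False using w assms by simp
      qed
      then have "w \<in> D" using w frontier_of_openin[OF op] by blast
      then show "w \<in> ?R" using w by simp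
    qed
    show "?R \<subseteq> ?L"
    proof
      fix w assume w: "w \<in> ?R"
      then have wE: "w \<in> topspace E" using D_subset by blast
      have "w i \<in> ?B i" for i
      proof (cases "i < n")
        case True
        then show ?thesis using coordinate_le_edist[OF True, of x w] w by auto
      next
        case False
        then show ?thesis using wE by (simp add: topspace_Euclidean_space)
      qed
      moreover have "w \<in> E closure_of D" using closure_of_subset[OF D_subset] w by blast
      ultimately show "w \<in> ?L" using w by auto
    qed
  qed
  ultimately show ?thesis by simp
qed

lemma D_curve:
  assumes "path_image \<gamma> \<subseteq> D"
  shows "path_image \<gamma> \<subseteq> topspace E"
  using assms D_subset by blast

section \<open>Quasihyperbolic length and distance\<close>

definition density :: "curve \<Rightarrow> real \<Rightarrow> real" where
  "density \<gamma> s = 1 / bd (arclength_point n \<gamma> s)"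

context
  fixes \<gamma> :: curve
  assumes rect: "rectifiable n \<gamma>" and im: "path_image \<gamma> \<subseteq> D"
begin

lemma arclength_point_in_D: "s \<in> {0..curve_length n \<gamma>} \<Longrightarrow> arclength_point n \<gamma> s \<in> D"
  using arclength_point_in_path_image[OF rect D_curve[OF im]] im by blast

lemma bdist_arclength_point_le:
  assumes "s \<in> {0..curve_length n \<gamma>}" "t \<in> {0..curve_length n \<gamma>}"
  shows "bd (arclength_point n \<gamma> t) \<le> bd (arclength_point n \<gamma> s) + \<bar>t - s\<bar>"
  using bdist_le_add[of "arclength_point n \<gamma> t" "arclength_point n \<gamma> s"]
    edist_arclength_point_le[OF rect D_curve[OF im] assms(2,1)] by linarith

lemma density_pos: "s \<in> {0..curve_length n \<gamma>} \<Longrightarrow> 0 < density \<gamma> s"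
  using bdist_pos arclength_point_in_D by (simp add: density_def)

lemma continuous_on_density: "continuous_on {0..curve_length n \<gamma>} (density \<gamma>)"
proof -
  have "continuous_on {0..curve_length n \<gamma>} (\<lambda>s. bd (arclength_point n \<gamma> s))"
    unfolding continuous_on_iff
  proof (intro ballI allI impI)
    fix s e :: real assume s: "s \<in> {0..curve_length n \<gamma>}" and "e > 0"
    have "\<bar>bd (arclength_point n \<gamma> t) - bd (arclength_point n \<gamma> s)\<bar> \<le> \<bar>t - s\<bar>"
      if "t \<in> {0..curve_length n \<gamma>}" for t
      using bdist_arclength_point_le[OF s that] bdist_arclength_point_le[OF that s] by linarith
    then show "\<exists>d>0. \<forall>t\<in>{0..curve_length n \<gamma>}. dist t s < d \<longrightarrow>
        dist (bd (arclength_point n \<gamma> t)) (bd (arclength_point n \<gamma> s)) < e"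
      using \<open>e > 0\<close> by (intro exI[of _ e]) (force simp: dist_real_def)
  qed
  then show ?thesis
    unfolding density_def using bdist_pos arclength_point_in_D
    by (intro continuous_on_divide continuous_on_const) force+
qed

lemma density_integrable:
  "0 \<le> s \<Longrightarrow> t \<le> curve_length n \<gamma> \<Longrightarrow> density \<gamma> integrable_on {s..t}"
  using continuous_on_density by (intro integrable_continuous_real) (auto elim: continuous_on_subset)

lemma qh_length_subcurve:
  assumes "0 \<le> u" "u \<le> v" "v \<le> 1"
  shows "qh_length n D (subcurve u v \<gamma>) = integral {arc_length n \<gamma> u..arc_length n \<gamma> v} (density \<gamma>)"
  unfolding qh_length_def line_integral_subcurve[OF rect D_curve[OF im] assms]
  by (simp add: density_def[abs_def])

lemma qh_length_eq: "qh_length n D \<gamma> = integral {0..curve_length n \<gamma>} (density \<gamma>)"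
  using qh_length_subcurve[of 0 1] rect by simp

lemma curve_length_nonneg: "0 \<le> curve_length n \<gamma>"
  using arc_length_mono[OF rect, of 0 1] rect by simp

lemma integral_density_nonneg:
  assumes "0 \<le> s" "t \<le> curve_length n \<gamma>"
  shows "0 \<le> integral {s..t} (density \<gamma>)"
  using density_integrable[OF assms] density_pos assms
  by (intro integral_nonneg) (auto intro: less_imp_le)

text \<open>Along arc length \<open>bd\<close> grows at most at unit speed, so
  \<open>density\<close> dominates \<open>1 / (bd (pathstart \<gamma>) + r)\<close>. The lower
  bounds on \<open>k\<close> in Euclidean terms come from here.\<close>

lemma ln_le_qh_length:
  "ln (1 + curve_length n \<gamma> / bd (pathstart \<gamma>)) \<le> qh_length n D \<gamma>"
proof -
  let ?l = "curve_length n \<gamma>" and ?b = "bd (pathstart \<gamma>)"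
  have start: "arclength_point n \<gamma> 0 = pathstart \<gamma>"
    using arclength_point_arc_length[OF rect D_curve[OF im], of 0] rect by (simp add: pathstart_def)
  have b: "?b > 0" using bdist_pos im pathstart_in_path_image by blast
  have I: "(density \<gamma> has_integral qh_length n D \<gamma>) {0..?l}"
    unfolding qh_length_eq using density_integrable by (intro integrable_integral) auto
  have "((\<lambda>r. 1 / (?b + r)) has_integral (ln (?b + ?l) - ln (?b + 0))) {0..?l}"
    using b curve_length_nonneg by (intro has_integral_inverse_affine) auto
  then have "ln (?b + ?l) - ln (?b + 0) \<le> qh_length n D \<gamma>"
  proof (rule has_integral_le[OF _ I])
    fix r assume r: "r \<in> {0..?l}"
    then have "bd (arclength_point n \<gamma> r) \<le> ?b + r"
      using bdist_arclength_point_le[of 0 r] start by simp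
    then show "1 / (?b + r) \<le> density \<gamma> r"
      unfolding density_def using bdist_pos[OF arclength_point_in_D[OF r]] by (intro divide_left_mono) auto
  qed
  moreover have "ln (?b + ?l) - ln ?b = ln ((?b + ?l) / ?b)"
    using b curve_length_nonneg by (simp add: ln_div)
  ultimately show ?thesis using b by (simp add: add_divide_distrib)
qed

end

lemma qh_length_nonneg:
  assumes "rectifiable n \<gamma>" "path_image \<gamma> \<subseteq> D"
  shows "0 \<le> qh_length n D \<gamma>"
  using integral_density_nonneg[OF assms, of 0 "curve_length n \<gamma>"] qh_length_eq[OF assms] by simp

definition joining :: "point \<Rightarrow> point \<Rightarrow> curve \<Rightarrow> bool" where
  "joining x y \<gamma> \<longleftrightarrow> rectifiable n \<gamma> \<and> path_image \<gamma> \<subseteq> D \<and> pathstart \<gamma> = x \<and> pathfinish \<gamma> = y"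

lemma qh_dist_eq: "k x y = Inf {qh_length n D \<gamma> | \<gamma>. joining x y \<gamma>}"
  by (simp add: qh_dist_def joining_def)

lemma bdd_below_qh_lengths: "bdd_below {qh_length n D \<gamma> | \<gamma>. joining x y \<gamma>}"
  using qh_length_nonneg by (intro bdd_belowI[of _ 0]) (auto simp: joining_def)

lemma qh_dist_le: "joining x y \<gamma> \<Longrightarrow> k x y \<le> qh_length n D \<gamma>"
  unfolding qh_dist_eq by (intro cInf_lower bdd_below_qh_lengths) auto

lemma qh_dist_commute: "k x y = k y x"
proof -
  have "\<exists>\<gamma>'. joining y x \<gamma>' \<and> qh_length n D \<gamma>' = qh_length n D \<gamma>" if "joining x y \<gamma>" for x y \<gamma>
    using that line_integral_reversepath[of n \<gamma>] rectifiable_reversepath D_curve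
    by (intro exI[of _ "reversepath \<gamma>"]) (auto simp: joining_def qh_length_def)
  then have "{qh_length n D \<gamma> | \<gamma>. joining x y \<gamma>} \<subseteq> {qh_length n D \<gamma> | \<gamma>. joining y x \<gamma>}" for x y
    by (clarsimp, metis)
  then have "{qh_length n D \<gamma> | \<gamma>. joining x y \<gamma>} = {qh_length n D \<gamma> | \<gamma>. joining y x \<gamma>}"
    by (intro equalityI)
  then show ?thesis by (simp add: qh_dist_eq)
qed

lemma qh_dist_arclength_le:
  assumes rect: "rectifiable n \<gamma>" and im: "path_image \<gamma> \<subseteq> D"
    and st: "0 \<le> s" "s \<le> t" "t \<le> curve_length n \<gamma>"
  shows "k (arclength_point n \<gamma> s) (arclength_point n \<gamma> t) \<le> integral {s..t} (density \<gamma>)"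
proof -
  note E = D_curve[OF im]
  have "\<exists>u v. 0 \<le> u \<and> u \<le> v \<and> v \<le> 1 \<and> arc_length n \<gamma> u = s \<and> arc_length n \<gamma> v = t"
  proof -
    obtain u where u: "u \<in> {0..1}" "arc_length n \<gamma> u = s"
      using arc_length_surj[OF rect, of s] st by auto
    obtain v where v: "v \<in> {0..1}" "arc_length n \<gamma> v = t"
      using arc_length_surj[OF rect, of t] st by auto
    show ?thesis
    proof (cases "u \<le> v")
      case True then show ?thesis using u v by auto
    next
      case False
      \<comment> \<open>The two parameters come out in the wrong order only if \<open>s = t\<close>,
        and then \<open>u\<close> serves for both.\<close>
      then have "s = t" using arc_length_mono[OF rect, of v u] u v st by auto
      then show ?thesis using u by auto
    qed
  qed
  then obtain u v where uv: "0 \<le> u" "u \<le> v" "v \<le> 1" "arc_length n \<gamma> u = s" "arc_length n \<gamma> v = t"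
    by blast
  have "path \<gamma>" using rect by (simp add: rectifiable_def)
  then have "path_image (subcurve u v \<gamma>) \<subseteq> D"
    using path_subcurve(2)[of \<gamma> u v] uv im by (auto simp: path_image_def)
  moreover have "pathstart (subcurve u v \<gamma>) = \<gamma> u" "pathfinish (subcurve u v \<gamma>) = \<gamma> v"
    by (simp_all add: pathstart_def pathfinish_def subcurve_def)
  moreover have "arclength_point n \<gamma> s = \<gamma> u" "arclength_point n \<gamma> t = \<gamma> v"
    using arclength_point_arc_length[OF rect E, of u] arclength_point_arc_length[OF rect E, of v] uv by auto
  ultimately have "joining (arclength_point n \<gamma> s) (arclength_point n \<gamma> t) (subcurve u v \<gamma>)"
    using rectifiable_subcurve[OF rect] uv by (simp add: joining_def)
  from qh_dist_le[OF this] show ?thesis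
    using qh_length_subcurve[OF rect im uv(1-3)] uv by simp
qed

text \<open>Local comparison of \<open>k\<close> with the Euclidean distance, the source of
  continuity of \<open>k\<close>. The case \<open>w = z\<close> also joins a point to itself, which
  no arc can do.\<close>

lemma short_segment:
  assumes z: "z \<in> D"
  obtains r where "r > 0" "\<And>w. w \<in> D \<Longrightarrow> edist n z w < r \<Longrightarrow> \<exists>\<gamma>. joining z w \<gamma>"
    "\<And>w. w \<in> D \<Longrightarrow> edist n z w < r \<Longrightarrow> k z w \<le> 2 / bd z * edist n z w"
proof -
  obtain e where e: "e > 0" "\<And>w. w \<in> topspace E \<Longrightarrow> edist n z w < e \<Longrightarrow> w \<in> D"
    using ball_subset[OF z] by blast
  \<comment> \<open>\<open>e\<close> keeps the segment inside \<open>D\<close>;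
    \<open>bd z / 2\<close> keeps \<open>bd\<close> above half its value at \<open>z\<close>, hence
    the factor 2.\<close>
  define r where "r = min e (bd z / 2)"
  have b: "bd z > 0" using bdist_pos z .
  have r0: "r > 0" using e b by (simp add: r_def)
  have "\<exists>\<gamma>. joining z w \<gamma> \<and> qh_length n D \<gamma> \<le> 2 / bd z * edist n z w"
    if w: "w \<in> D" "edist n z w < r" for w
  proof -
    define \<sigma> where "\<sigma> t i = z i + t * (w i - z i)" for t :: real and i :: nat
    have len: "edist n (\<sigma> s) (\<sigma> t) = (t - s) * edist n z w" if "s \<le> t" for s t
    proof -
      have "edist n (\<sigma> t) (\<sigma> s) = L2_set (\<lambda>i. (t - s) * (w i - z i)) {..<n}"
        unfolding edist_def \<sigma>_def by (intro L2_set_cong) (auto simp: algebra_simps)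
      also have "\<dots> = (t - s) * edist n w z"
        using that by (simp add: edist_def L2_set_right_distrib)
      finally show ?thesis by (simp add: edist_commute)
    qed
    have path: "path \<sigma>"
      unfolding path_def \<sigma>_def
      by (rule continuous_on_coordinatewise_then_product) (intro continuous_intros)
    have sums: "x \<le> edist n z w" if x: "x \<in> polygonal_lengths n \<sigma>" for x
    proof -
      obtain m t where t: "is_partition 0 1 m t" "x = partition_sum n \<sigma> m t"
        using x by (auto simp: polygonal_lengths_eq partition_sums_def)
      have "x = (\<Sum>i<m. (t (Suc i) - t i) * edist n z w)"
        unfolding t(2) partition_sum_def using t(1) by (intro sum.cong) (auto simp: is_partition_def len)
      also have "\<dots> = (t m - t 0) * edist n z w"
        by (simp add: sum_lessThan_telescope flip: sum_distrib_right)
      also have "\<dots> \<le> 1 * edist n z w"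
        using t(1) by (intro mult_right_mono) (auto simp: is_partition_def intro: order_trans[of _ "t m"])
      finally show ?thesis by simp
    qed
    have rect: "rectifiable n \<sigma>" using path sums by (auto simp: rectifiable_def bdd_above_def)
    have l: "curve_length n \<sigma> \<le> edist n z w"
      unfolding curve_length_def using sums partition_sums_nonempty[of 0 1]
      by (intro cSup_least) (auto simp: polygonal_lengths_eq)
    have near: "edist n z (\<sigma> t) \<le> edist n z w" "\<sigma> t \<in> topspace E" if "t \<in> {0..1}" for t
    proof -
      have "edist n (\<sigma> 0) (\<sigma> t) \<le> edist n z w"
        using len[of 0 t] that by (simp add: mult_left_le_one_le)
      moreover have "\<sigma> 0 = z" by (simp add: \<sigma>_def fun_eq_iff)
      ultimately show "edist n z (\<sigma> t) \<le> edist n z w" by simp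
      show "\<sigma> t \<in> topspace E"
        using subsetD[OF D_subset z] subsetD[OF D_subset w(1)]
        by (simp add: topspace_Euclidean_space \<sigma>_def)
    qed
    have im: "path_image \<sigma> \<subseteq> D"
    proof -
      have "\<sigma> t \<in> D" if "t \<in> {0..1}" for t
        using near[OF that] w e(2) unfolding r_def by (meson min_less_iff_conj order_le_less_trans)
      then show ?thesis by (auto simp: path_image_def)
    qed
    have "\<sigma> 0 = z" "\<sigma> 1 = w" by (auto simp: \<sigma>_def)
    then have J: "joining z w \<sigma>" using rect im by (simp add: joining_def pathstart_def pathfinish_def)
    have "density \<sigma> s \<le> 2 / bd z" if s: "s \<in> {0..curve_length n \<sigma>}" for s
    proof -
      have "arclength_point n \<sigma> s \<in> path_image \<sigma>"
        using arclength_point_in_path_image[OF rect D_curve[OF im] s] .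
      then obtain t where t: "t \<in> {0..1}" "arclength_point n \<sigma> s = \<sigma> t"
        by (auto simp: path_image_def)
      have "bd z \<le> bd (\<sigma> t) + edist n z (\<sigma> t)" by (rule bdist_le_add)
      then have "bd z / 2 \<le> bd (\<sigma> t)" using near(1)[OF t(1)] w by (simp add: r_def)
      then have "1 / bd (\<sigma> t) \<le> 1 / (bd z / 2)" using b by (intro divide_left_mono) auto
      then show ?thesis by (simp add: density_def t(2))
    qed
    then have "integral {0..curve_length n \<sigma>} (density \<sigma>) \<le> integral {0..curve_length n \<sigma>} (\<lambda>_. 2 / bd z)"
      using density_integrable[OF rect im] by (intro integral_le) auto
    also have "\<dots> = 2 / bd z * curve_length n \<sigma>"
      using curve_length_nonneg[OF rect im] by simp
    also have "\<dots> \<le> 2 / bd z * edist n z w" using l b by (intro mult_left_mono) auto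
    finally show ?thesis using J qh_length_eq[OF rect im] by auto
  qed
  then show thesis
    using that[OF r0] qh_dist_le by (meson order_trans)
qed

end

lemma closedin_Collect_ball:
  assumes "I \<noteq> {}" "\<And>p. p \<in> I \<Longrightarrow> closedin X {h \<in> topspace X. Q p h}"
  shows "closedin X {h \<in> topspace X. \<forall>p\<in>I. Q p h}"
proof -
  have "{h \<in> topspace X. \<forall>p\<in>I. Q p h} = (\<Inter>p\<in>I. {h \<in> topspace X. Q p h})"
    using assms(1) by blast
  then show ?thesis using closedin_INT[OF assms] by simp
qed

section \<open>Metric properties of the quasihyperbolic distance\<close>

text \<open>Joinability makes every infimum \<open>k x y\<close> range over a nonempty set; in a
  John domain the cone arcs supply it.\<close>

locale connected_subdomain = subdomain +
  assumes joining_exists: "x \<in> D \<Longrightarrow> y \<in> D \<Longrightarrow> \<exists>\<gamma>. joining x y \<gamma>"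
begin

lemma qh_lengths_nonempty: "x \<in> D \<Longrightarrow> y \<in> D \<Longrightarrow> {qh_length n D \<gamma> | \<gamma>. joining x y \<gamma>} \<noteq> {}"
  using joining_exists by blast

lemma qh_dist_approx:
  assumes "x \<in> D" "y \<in> D" "e > 0"
  obtains \<gamma> where "joining x y \<gamma>" "qh_length n D \<gamma> < k x y + e"
proof -
  have "k x y < k x y + e" using assms by simp
  then have "\<exists>l\<in>{qh_length n D \<gamma> | \<gamma>. joining x y \<gamma>}. l < k x y + e"
    unfolding qh_dist_eq using cInf_less_iff[OF qh_lengths_nonempty bdd_below_qh_lengths] assms by blast
  then show thesis using that by blast
qed

lemma qh_dist_ge:
  assumes "x \<in> D" "y \<in> D"
  shows "ln (1 + edist n x y / bd x) \<le> k x y"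
  unfolding qh_dist_eq
proof (rule cInf_greatest[OF qh_lengths_nonempty[OF assms]])
  fix l assume "l \<in> {qh_length n D \<gamma> | \<gamma>. joining x y \<gamma>}"
  then obtain \<gamma> where \<gamma>: "rectifiable n \<gamma>" "path_image \<gamma> \<subseteq> D" "\<gamma> 0 = x" "\<gamma> 1 = y" "l = qh_length n D \<gamma>"
    by (auto simp: joining_def pathstart_def pathfinish_def)
  have b: "bd x > 0" using bdist_pos assms by blast
  have "edist n x y \<le> curve_length n \<gamma>"
    using edist_le_arc_length[OF \<gamma>(1), of 0 1] \<gamma> by simp
  then have "edist n x y / bd x \<le> curve_length n \<gamma> / bd x" using b by (simp add: divide_right_mono)
  moreover have "0 \<le> edist n x y / bd x" using b by simp
  ultimately have "ln (1 + edist n x y / bd x) \<le> ln (1 + curve_length n \<gamma> / bd x)" by simp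
  also have "\<dots> \<le> l" using ln_le_qh_length[OF \<gamma>(1,2)] \<gamma> by (simp add: pathstart_def)
  finally show "ln (1 + edist n x y / bd x) \<le> l" .
qed

lemma qh_dist_nonneg:
  assumes "x \<in> D" "y \<in> D"
  shows "0 \<le> k x y"
proof -
  have "0 \<le> ln (1 + edist n x y / bd x)" using bdist_pos[OF assms(1)] by simp
  then show ?thesis using qh_dist_ge[OF assms] by linarith
qed

lemma edist_le_exp_qh_dist:
  assumes "x \<in> D" "y \<in> D"
  shows "bd x + edist n x y \<le> bd x * exp (k x y)"
proof -
  have b: "bd x > 0" using bdist_pos assms by blast
  then have "1 + edist n x y / bd x > 0" by (simp add: add_pos_nonneg)
  moreover have "exp (ln (1 + edist n x y / bd x)) \<le> exp (k x y)" using qh_dist_ge[OF assms] by simp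
  ultimately have "1 + edist n x y / bd x \<le> exp (k x y)" by simp
  then have "bd x * (1 + edist n x y / bd x) \<le> bd x * exp (k x y)"
    using b by (intro mult_left_mono) auto
  then show ?thesis using b by (simp add: distrib_left)
qed

lemma qh_dist_eq_0:
  assumes "x \<in> D" "y \<in> D" "k x y \<le> 0"
  shows "x = y"
proof -
  have b: "bd x > 0" using bdist_pos assms by blast
  have "bd x * exp (k x y) \<le> bd x * 1" using b assms(3) by (intro mult_left_mono) auto
  then have "edist n x y \<le> 0" using edist_le_exp_qh_dist[OF assms(1,2)] by simp
  then show ?thesis
    using edist_eq_0[of n x y] edist_nonneg[of n x y] assms D_subset by (meson antisym subsetD)
qed

text \<open>\<open>bd y \<le> bd x + edist n x y \<le> bd x * exp (k x y)\<close>, and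
  symmetrically. This makes \<open>ln bd\<close> a height in the sense of
  \<open>height_space\<close>.\<close>

lemma ln_bdist_lipschitz:
  assumes "x \<in> D" "y \<in> D"
  shows "\<bar>ln (bd x) - ln (bd y)\<bar> \<le> k x y"
proof -
  have "ln (bd y) \<le> ln (bd x) + k x y" if "x \<in> D" "y \<in> D" for x y
  proof -
    have b: "bd x > 0" "bd y > 0" using bdist_pos that by auto
    have "bd y \<le> bd x * exp (k x y)"
      using bdist_le_add[of y x] edist_le_exp_qh_dist[OF that] edist_commute[of n x y] by linarith
    then have "ln (bd y) \<le> ln (bd x * exp (k x y))" using b by simp
    then show ?thesis using b by (simp add: ln_mult)
  qed
  from this[OF assms] this[OF assms(2,1)] show ?thesis using qh_dist_commute[of x y] by linarith
qed

lemma qh_dist_refl: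
  assumes "x \<in> D"
  shows "k x x = 0"
proof -
  obtain r where "r > 0" "\<And>w. w \<in> D \<Longrightarrow> edist n x w < r \<Longrightarrow> k x w \<le> 2 / bd x * edist n x w"
    using short_segment[OF assms] by metis
  from this(2)[OF assms] this(1) have "k x x \<le> 0" by simp
  then show ?thesis using qh_dist_nonneg[OF assms assms] by simp
qed

lemma qh_dist_triangle:
  assumes "x \<in> D" "y \<in> D" "z \<in> D"
  shows "k x z \<le> k x y + k y z"
proof (rule field_le_epsilon)
  fix e :: real assume "e > 0"
  then have e: "e / 2 > 0" by simp
  obtain \<alpha> where \<alpha>: "joining x y \<alpha>" "qh_length n D \<alpha> < k x y + e / 2"
    using qh_dist_approx[OF assms(1,2) e] .
  obtain \<beta> where \<beta>: "joining y z \<beta>" "qh_length n D \<beta> < k y z + e / 2"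
    using qh_dist_approx[OF assms(2,3) e] .
  let ?\<gamma> = "\<alpha> +++ \<beta>"
  have ends: "pathfinish \<alpha> = pathstart \<beta>" using \<alpha> \<beta> by (simp add: joining_def)
  have J: "joining x z ?\<gamma>"
    using \<alpha> \<beta> ends rectifiable_joinpaths[of n \<alpha> \<beta>] path_image_join_subset[of \<alpha> \<beta>]
    by (auto simp: joining_def)
  then have rect: "rectifiable n ?\<gamma>" and im: "path_image ?\<gamma> \<subseteq> D" by (auto simp: joining_def)
  have "qh_length n D (subcurve 0 (1/2) ?\<gamma>) = qh_length n D \<alpha>"
    "qh_length n D (subcurve (1/2) 1 ?\<gamma>) = qh_length n D \<beta>"
    unfolding qh_length_def using subcurve_joinpaths[OF ends] by (auto intro: line_integral_cong)
  moreover have "integral {0..arc_length n ?\<gamma> (1/2)} (density ?\<gamma>) +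
      integral {arc_length n ?\<gamma> (1/2)..curve_length n ?\<gamma>} (density ?\<gamma>) =
      integral {0..curve_length n ?\<gamma>} (density ?\<gamma>)"
    using arc_length_mono[OF rect, of 0 "1/2"] arc_length_mono[OF rect, of "1/2" 1] rect
    by (intro Henstock_Kurzweil_Integration.integral_combine density_integrable[OF rect im]) auto
  ultimately have "qh_length n D ?\<gamma> = qh_length n D \<alpha> + qh_length n D \<beta>"
    using qh_length_subcurve[OF rect im, of 0 "1/2"] qh_length_subcurve[OF rect im, of "1/2" 1]
      qh_length_eq[OF rect im] rect by simp
  then show "k x z \<le> k x y + k y z + e"
    using qh_dist_le[OF J] \<alpha>(2) \<beta>(2) by simp
qed

text \<open>Stated with open sets of the product topology, because the overloaded
  \<open>dist\<close> on sequences is not \<open>edist\<close>.\<close>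

lemma qh_dist_small:
  assumes "z \<in> D" "e > 0"
  obtains U where "open U" "z \<in> U" "\<And>w. w \<in> U \<inter> D \<Longrightarrow> k z w < e"
proof -
  obtain r where r: "r > 0" "\<And>w. w \<in> D \<Longrightarrow> edist n z w < r \<Longrightarrow> k z w \<le> 2 / bd z * edist n z w"
    using short_segment[OF assms(1)] by metis
  have b: "bd z > 0" using bdist_pos assms by blast
  define U where "U = {w. edist n z w < min r (e * bd z / 2)}"
  have "open U" unfolding U_def
    by (intro open_Collect_less continuous_on_edist continuous_intros)
  moreover have "z \<in> U" using r b assms by (simp add: U_def)
  moreover have "k z w < e" if "w \<in> U \<inter> D" for w
  proof -
    have "2 / bd z * edist n z w < 2 / bd z * (e * bd z / 2)"
      using that b by (intro mult_strict_left_mono) (auto simp: U_def)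
    then show ?thesis using r(2)[of w] that b by (simp add: U_def)
  qed
  ultimately show thesis using that by blast
qed

lemma continuous_on_qh_dist: "continuous_on (D \<times> D) (\<lambda>p. k (fst p) (snd p))"
  unfolding continuous_on_def
proof (intro ballI tendstoI)
  fix p :: "point \<times> point" and e :: real assume p: "p \<in> D \<times> D" and "e > 0"
  then have e: "e / 2 > 0" by simp
  have pD: "fst p \<in> D" "snd p \<in> D" using p by auto
  obtain U where U: "open U" "fst p \<in> U" "\<And>w. w \<in> U \<inter> D \<Longrightarrow> k (fst p) w < e / 2"
    using qh_dist_small[OF pD(1) e] by metis
  obtain V where V: "open V" "snd p \<in> V" "\<And>w. w \<in> V \<inter> D \<Longrightarrow> k (snd p) w < e / 2"
    using qh_dist_small[OF pD(2) e] by metis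
  have "dist (k (fst q) (snd q)) (k (fst p) (snd p)) < e" if q: "q \<in> U \<times> V" "q \<in> D \<times> D" for q
  proof -
    have qD: "fst q \<in> D" "snd q \<in> D" using q by auto
    have "k (fst q) (snd q) \<le> k (fst q) (fst p) + k (fst p) (snd q)"
      "k (fst p) (snd q) \<le> k (fst p) (snd p) + k (snd p) (snd q)"
      "k (fst p) (snd p) \<le> k (fst p) (fst q) + k (fst q) (snd p)"
      "k (fst q) (snd p) \<le> k (fst q) (snd q) + k (snd q) (snd p)"
      using pD qD by (auto intro: qh_dist_triangle)
    moreover have "k (fst p) (fst q) < e / 2" "k (snd p) (snd q) < e / 2" using U V q by auto
    ultimately show ?thesis
      using qh_dist_commute[of "fst p" "fst q"] qh_dist_commute[of "snd p" "snd q"]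
      unfolding dist_real_def by linarith
  qed
  moreover have "open (U \<times> V)" "p \<in> U \<times> V" using U V by (auto simp: open_Times mem_Times_iff)
  ultimately show "\<forall>\<^sub>F q in at p within D \<times> D. dist (k (fst q) (snd q)) (k (fst p) (snd p)) < e"
    unfolding eventually_at_topological by blast
qed

section \<open>Existence of quasihyperbolic geodesics\<close>

text \<open>Parametrise a nearly minimal curve proportionally to its quasihyperbolic length.\<close>

lemma almost_geodesic:
  assumes "x \<in> D" "y \<in> D" "k x y > 0" "e > 0"
  obtains h where "\<And>s. s \<in> {0..k x y} \<Longrightarrow> h s \<in> D"
    "\<And>s t. s \<in> {0..k x y} \<Longrightarrow> t \<in> {0..k x y} \<Longrightarrow> k (h s) (h t) \<le> \<bar>s - t\<bar> + e"
    "h 0 = x" "h (k x y) = y"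
proof -
  define L where "L = k x y"
  obtain \<gamma> where \<gamma>: "joining x y \<gamma>" "qh_length n D \<gamma> < L + e"
    using qh_dist_approx[OF assms(1,2,4)] unfolding L_def .
  have rect: "rectifiable n \<gamma>" and im: "path_image \<gamma> \<subseteq> D" using \<gamma> by (auto simp: joining_def)
  define l g where "l = curve_length n \<gamma>" and "g = arclength_point n \<gamma>"
  define G where "G s = integral {0..s} (density \<gamma>)" for s
  have l0: "l \<ge> 0" using curve_length_nonneg[OF rect im] by (simp add: l_def)
  have gx: "g 0 = x" "g l = y"
    using arclength_point_arc_length[OF rect D_curve[OF im], of 0]
      arclength_point_arc_length[OF rect D_curve[OF im], of 1] rect \<gamma>(1)
    by (auto simp: g_def l_def joining_def pathstart_def pathfinish_def)
  define \<Lambda> where "\<Lambda> = G l"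
  have \<Lambda>: "L \<le> \<Lambda>" "\<Lambda> < L + e"
    using \<gamma> qh_dist_le[OF \<gamma>(1)] qh_length_eq[OF rect im] by (auto simp: \<Lambda>_def G_def l_def L_def)
  have L0: "L > 0" using assms by (simp add: L_def)
  have Gk: "k (g s) (g t) \<le> G t - G s" if "0 \<le> s" "s \<le> t" "t \<le> l" for s t
  proof -
    have "G s + integral {s..t} (density \<gamma>) = G t"
      unfolding G_def using that
      by (intro Henstock_Kurzweil_Integration.integral_combine density_integrable[OF rect im]) (auto simp: l_def)
    then show ?thesis
      using qh_dist_arclength_le[OF rect im that[unfolded l_def]] unfolding g_def by linarith
  qed
  have contG: "continuous_on {0..l} G"
    unfolding G_def by (intro indefinite_integral_continuous_1 density_integrable[OF rect im]) (auto simp: l_def)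
  \<comment> \<open>The curve has length \<open>\<Lambda>\<close> possibly above \<open>L\<close>;
    rescaling by \<open>\<Lambda> / L\<close> fits it to \<open>{0..L}\<close> at a cost of at most
    \<open>e\<close>.\<close>
  have "\<exists>\<sigma>\<in>{0..l}. G \<sigma> = s * \<Lambda> / L" if "s \<in> {0..L}" for s
  proof -
    have "0 \<le> s * \<Lambda> / L" "s * \<Lambda> / L \<le> \<Lambda>"
      using that L0 \<Lambda> by (auto simp: divide_simps mult.commute mult_right_mono)
    then show ?thesis
      using IVT'[of G 0 "s * \<Lambda> / L" l] contG l0 by (force simp: G_def \<Lambda>_def)
  qed
  then obtain \<sigma> where \<sigma>: "\<And>s. s \<in> {0..L} \<Longrightarrow> \<sigma> s \<in> {0..l}" "\<And>s. s \<in> {0..L} \<Longrightarrow> G (\<sigma> s) = s * \<Lambda> / L"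
    by metis
  define h where "h s = g (\<sigma> s)" for s
  have hD: "h s \<in> D" if "s \<in> {0..L}" for s
    using arclength_point_in_D[OF rect im] \<sigma>(1)[OF that] by (simp add: h_def g_def l_def)
  have kG: "k (g s) (g t) \<le> \<bar>G s - G t\<bar>" if "s \<in> {0..l}" "t \<in> {0..l}" for s t
    using Gk[of s t] Gk[of t s] that qh_dist_commute[of "g s" "g t"] by (cases "s \<le> t") auto
  have hk: "k (h s) (h t) \<le> \<bar>s - t\<bar> + e" if st: "s \<in> {0..L}" "t \<in> {0..L}" for s t
  proof -
    have "k (h s) (h t) \<le> \<bar>s * \<Lambda> / L - t * \<Lambda> / L\<bar>"
      using kG[OF \<sigma>(1)[OF st(1)] \<sigma>(1)[OF st(2)]] \<sigma>(2) st by (simp add: h_def)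
    also have "\<dots> = \<bar>s - t\<bar> * \<Lambda> / L"
      using L0 \<Lambda> by (simp add: abs_mult left_diff_distrib[symmetric] diff_divide_distrib[symmetric])
    also have "\<dots> \<le> \<bar>s - t\<bar> * (L + e) / L"
      using L0 \<Lambda> by (intro divide_right_mono mult_left_mono) auto
    also have "\<dots> = \<bar>s - t\<bar> + \<bar>s - t\<bar> / L * e" using L0 by (simp add: field_simps)
    also have "\<dots> \<le> \<bar>s - t\<bar> + 1 * e"
      using st L0 assms(4) by (intro add_left_mono mult_right_mono) (auto simp: divide_simps)
    finally show ?thesis by simp
  qed
  \<comment> \<open>\<open>\<sigma> 0\<close> and \<open>\<sigma> L\<close> are known only through
    their \<open>G\<close>-values; equal values still put the points at \<open>k\<close>-distance
    0.\<close>
  have "k x (h 0) \<le> \<bar>G 0 - G (\<sigma> 0)\<bar>" "k (h L) y \<le> \<bar>G (\<sigma> L) - G l\<bar>"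
    using kG[of 0 "\<sigma> 0"] kG[of "\<sigma> L" l] \<sigma>(1)[of 0] \<sigma>(1)[of L] L0 l0 gx by (auto simp: h_def)
  then have "k x (h 0) \<le> 0" "k (h L) y \<le> 0"
    using \<sigma>(2)[of 0] \<sigma>(2)[of L] L0 by (auto simp: G_def \<Lambda>_def)
  then have "h 0 = x" "h L = y"
    using qh_dist_eq_0 hD[of 0] hD[of L] L0 assms by auto
  then show thesis using that[of h] hD hk by (auto simp: L_def)
qed

text \<open>A geodesic is a cluster point of almost geodesics in a product of copies of a compact set, which is
  compact by Tychonoff's theorem.\<close>

lemma qh_geodesic_exists:
  assumes xy: "x \<in> D" "y \<in> D"
  shows "\<exists>S. geodesic_segment D k x y S"
proof (cases "k x y \<le> 0")
  case True
  then have "x = y" using qh_dist_eq_0 xy by blast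
  then have "geodesic_segment D k x y {x}"
    unfolding geodesic_segment_def using xy qh_dist_refl by (intro exI[of _ "\<lambda>_. x"]) auto
  then show ?thesis by blast
next
  case False
  define L where "L = k x y"
  have L0: "L > 0" using False by (simp add: L_def)
  have b: "bd x > 0" using bdist_pos xy by blast
  \<comment> \<open>Almost geodesics with error at most 1 stay within \<open>k\<close>-distance
    \<open>L + 1\<close> of \<open>x\<close>; exponentiating gives these bounds on \<open>bd\<close>
    and \<open>edist\<close>.\<close>
  define K where "K = {w \<in> D. bd x * exp (- (L + 1)) \<le> bd w \<and> edist n x w \<le> bd x * exp (L + 1)}"
  have KD: "K \<subseteq> D" by (auto simp: K_def)
  have "compact K" unfolding K_def using b by (intro compact_truncation) simp
  \<comment> \<open>Arbitrary functions with pointwise convergence suffice: being an isometry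
    involves only pairs of values.\<close>
  define X where "X = product_topology (\<lambda>_::real. top_of_set K) UNIV"
  have topX: "topspace X = {h. \<forall>s. h s \<in> K}" by (auto simp: X_def topspace_product_topology)
  have X: "compact_space X"
    unfolding X_def compact_space_product_topology
    using \<open>compact K\<close> by (auto intro: compact_space_subtopology)
  have inK: "w \<in> K" if "w \<in> D" "k x w \<le> L + 1" for w
  proof -
    have "bd w > 0" using bdist_pos that by blast
    have "bd x + edist n x w \<le> bd x * exp (k x w)" using edist_le_exp_qh_dist xy that by blast
    also have "\<dots> \<le> bd x * exp (L + 1)" using that b by simp
    finally have 1: "edist n x w \<le> bd x * exp (L + 1)" using b by linarith
    have "\<bar>ln (bd x) - ln (bd w)\<bar> \<le> L + 1" using ln_bdist_lipschitz[OF xy(1) that(1)] that(2) by linarith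
    then have "ln (bd x) + - (L + 1) \<le> ln (bd w)" by linarith
    then have "exp (ln (bd x) + - (L + 1)) \<le> exp (ln (bd w))" by (rule exp_le_cancel_iff[THEN iffD2])
    then have "bd x * exp (- (L + 1)) \<le> bd w"
      using b \<open>bd w > 0\<close> unfolding exp_add by simp
    then show ?thesis using 1 that by (simp add: K_def)
  qed
  have contk: "continuous_map X euclideanreal (\<lambda>h. k (h s) (h t))" for s t
  proof -
    have "continuous_map X (prod_topology (top_of_set K) (top_of_set K)) (\<lambda>h. (h s, h t))"
      unfolding X_def by (intro continuous_map_pairedI continuous_map_product_projection) auto
    moreover have "continuous_map (top_of_set (K \<times> K)) euclideanreal (\<lambda>p. k (fst p) (snd p))"
      using continuous_on_qh_dist KD by (auto intro: continuous_on_subset)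
    ultimately have "continuous_map X euclideanreal ((\<lambda>p. k (fst p) (snd p)) \<circ> (\<lambda>h. (h s, h t)))"
      by (intro continuous_map_compose) auto
    then show ?thesis by (simp add: o_def)
  qed
  define I where "I = {0..L} \<times> {0..L}"
  \<comment> \<open>For fixed \<open>m\<close> a closed condition; the slack shrinks with
    \<open>m\<close>, so the sets \<open>C m\<close> are nested and a common element has no slack
    left.\<close>
  define Q where "Q m p h \<longleftrightarrow> k (h (fst p)) (h (snd p)) \<in> {..\<bar>fst p - snd p\<bar> + 1 / real (Suc m)}"
    for m :: nat and p :: "real \<times> real" and h :: "real \<Rightarrow> point"
  define C where "C m = {h \<in> topspace X. \<forall>p\<in>I. Q m p h} \<inter>
      ({h \<in> topspace X. h 0 \<in> {x}} \<inter> {h \<in> topspace X. h L \<in> {y}})" for m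
  have C_iff: "h \<in> C m \<longleftrightarrow> h \<in> topspace X \<and> (\<forall>p\<in>I. Q m p h) \<and> h 0 = x \<and> h L = y" for h m
    unfolding C_def by blast
  have xK: "x \<in> K" using inK[OF xy(1)] qh_dist_refl[OF xy(1)] L0 by simp
  have yK: "y \<in> K" using inK[OF xy(2)] L_def by simp
  have "(\<Inter>m. C m) \<noteq> {}"
  proof (rule compact_space_imp_nest[OF X])
    fix m
    have "closedin X {h \<in> topspace X. k (h s) (h t) \<in> {..c}}" for s t c
      by (rule closedin_continuous_map_preimage[OF contk]) simp
    moreover have "closedin X {h \<in> topspace X. h s \<in> {z}}" if "z \<in> K" for s z
    proof (rule closedin_continuous_map_preimage)
      show "continuous_map X (top_of_set K) (\<lambda>h. h s)"
        unfolding X_def by (rule continuous_map_product_projection) simp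
      show "closedin (top_of_set K) {z}" using that by (simp add: closedin_closed_eq closed_subset)
    qed
    moreover have "I \<noteq> {}" using L0 by (simp add: I_def)
    ultimately show "closedin X (C m)"
      unfolding C_def using xK yK by (intro closedin_Int closedin_Collect_ball) (simp_all add: Q_def)
    have "1 / real (Suc m) > 0" by simp
    from almost_geodesic[OF xy _ this] obtain h where h: "\<And>s. s \<in> {0..L} \<Longrightarrow> h s \<in> D"
      "\<And>s t. s \<in> {0..L} \<Longrightarrow> t \<in> {0..L} \<Longrightarrow> k (h s) (h t) \<le> \<bar>s - t\<bar> + 1 / real (Suc m)"
      "h 0 = x" "h L = y"
      using L0 unfolding L_def by blast
    \<comment> \<open>The product has a factor for every real, so \<open>h\<close> is extended by a
      point of \<open>K\<close>.\<close>
    define h' where "h' s = (if s \<in> {0..L} then h s else x)" for s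
    have "h' s \<in> K" for s
    proof (cases "s \<in> {0..L}")
      case True
      have "1 / real (Suc m) \<le> 1" by simp
      moreover have "k x (h s) \<le> s + 1 / real (Suc m)" using h(2)[of 0 s, unfolded h(3)] True L0 by simp
      moreover have "s \<le> L" using True by simp
      ultimately have "k x (h s) \<le> L + 1" by linarith
      then show ?thesis using inK h(1)[OF True] True by (simp add: h'_def)
    next
      case False
      then have "h' s = x" unfolding h'_def by (rule if_not_P)
      then show ?thesis using xK by simp
    qed
    then have h'X: "h' \<in> topspace X" by (simp add: topX)
    have "k (h' s) (h' t) \<le> \<bar>s - t\<bar> + 1 / real (Suc m)" if "s \<in> {0..L}" "t \<in> {0..L}" for s t
      using h(2)[OF that] that by (simp add: h'_def)
    then have "\<forall>p\<in>I. Q m p h'" unfolding I_def Q_def by (metis SigmaE atMost_iff fst_conv snd_conv)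
    moreover have "h' 0 = x" "h' L = y" using h(3,4) L0 by (simp_all add: h'_def)
    ultimately have "h' \<in> C m" using h'X unfolding C_iff by blast
    then show "C m \<noteq> {}" by blast
  next
    show "decseq C"
    proof (rule decseq_SucI, rule subsetI)
      fix m h assume h: "h \<in> C (Suc m)"
      have "1 / real (Suc (Suc m)) \<le> 1 / real (Suc m)" by (intro divide_left_mono) auto
      then have "c + 1 / real (Suc (Suc m)) \<le> c + 1 / real (Suc m)" for c :: real by simp
      then have "Q (Suc m) p h \<Longrightarrow> Q m p h" for p
        unfolding Q_def atMost_iff by (meson order_trans)
      then show "h \<in> C m" using h unfolding C_iff by blast
    qed
  qed
  then obtain h where h: "\<And>m. h \<in> C m" by blast
  have hK: "h s \<in> K" for s using h[of 0] unfolding C_iff topX by blast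
  have ends: "h 0 = x" "h L = y" using h[of 0] unfolding C_iff by blast+
  have le: "k (h s) (h t) \<le> \<bar>s - t\<bar>" if "s \<in> {0..L}" "t \<in> {0..L}" for s t
  proof (rule field_le_epsilon)
    fix e :: real assume "e > 0"
    then obtain m where m: "inverse (real (Suc m)) < e" using reals_Archimedean by blast
    have "k (h s) (h t) \<le> \<bar>s - t\<bar> + 1 / real (Suc m)"
    proof -
      have "Q m (s, t) h" using h[of m] that unfolding C_iff I_def by blast
      then show ?thesis by (simp add: Q_def)
    qed
    then show "k (h s) (h t) \<le> \<bar>s - t\<bar> + e" using m by (simp add: inverse_eq_divide)
  qed
  have hD: "h s \<in> D" for s using hK KD by blast
  \<comment> \<open>\<open>L \<le> s + k (h s) (h t) + (L - t)\<close>: the upper bounds towards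
    both ends force the lower bound in between.\<close>
  have ge: "t - s \<le> k (h s) (h t)" if "s \<in> {0..L}" "t \<in> {0..L}" "s \<le> t" for s t
  proof -
    have "L \<le> k x (h s) + k (h s) y" "k (h s) y \<le> k (h s) (h t) + k (h t) y"
      unfolding L_def using qh_dist_triangle hD xy by auto
    moreover have "k x (h s) \<le> s" "k (h t) y \<le> L - t"
      using le[of 0 s] le[of t L] that ends by auto
    ultimately show ?thesis by linarith
  qed
  have "k (h s) (h t) = \<bar>s - t\<bar>" if "s \<in> {0..L}" "t \<in> {0..L}" for s t
    using le[OF that] ge[of s t] ge[of t s] that qh_dist_commute[of "h s" "h t"] by (cases "s \<le> t") auto
  then have "geodesic_segment D k x y (h ` {0..L})"
    unfolding geodesic_segment_def L_def[symmetric] using ends hD by blast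
  then show ?thesis by blast
qed

subsection \<open>Cone arcs\<close>

lemma geodesic_space_qh: "geodesic_space D k"
  by unfold_locales
    (auto intro: qh_dist_nonneg qh_dist_refl qh_dist_commute qh_dist_triangle qh_geodesic_exists)

abbreviation "height z \<equiv> ln (bd z)"

text \<open>On the half of a cone arc starting at \<open>x\<close>, \<open>bd\<close> is comparable to \<open>bd x + s\<close> at arc length \<open>s\<close>;
  the rungs are the points where \<open>bd x + s\<close> doubles.\<close>

lemma cone_arc_half_ladder:
  assumes hs: "height_space D k \<delta> height (2 * a + 1) R" and "a \<ge> 1"
    and rect: "rectifiable n \<alpha>" and im: "path_image \<alpha> \<subseteq> D"
    and cone: "\<And>s. s \<in> {0..curve_length n \<alpha> / 2} \<Longrightarrow> s \<le> a * bd (arclength_point n \<alpha> s)"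
  shows "\<exists>N z. height_space.ladder D k height (2 * a + 1) N z \<and>
    z 0 = arclength_point n \<alpha> 0 \<and> z N = arclength_point n \<alpha> (curve_length n \<alpha> / 2)"
proof -
  define H A g where "H = curve_length n \<alpha> / 2" and "A = 2 * a + 1" and "g = arclength_point n \<alpha>"
  have H0: "H \<ge> 0" and Hl: "H \<le> curve_length n \<alpha>"
    using curve_length_nonneg[OF rect im] by (auto simp: H_def)
  have A3: "A \<ge> 3" using assms(2) by (simp add: A_def)
  have gD: "g s \<in> D" if "s \<in> {0..H}" for s
    using arclength_point_in_D[OF rect im, of s] that Hl by (simp add: g_def)
  define c where "c = bd (g 0)"
  have c0: "c > 0" unfolding c_def using gD H0 by (intro bdist_pos) auto
  \<comment> \<open>\<open>c \<le> bd (g s) + s\<close> as \<open>bd\<close> is 1-Lipschitz, and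
    \<open>s \<le> a * bd (g s)\<close> by the cone condition; adding \<open>s\<close> twice gives
    \<open>A = 2 * a + 1\<close>.\<close>
  have low: "c + s \<le> A * bd (g s)" and up: "bd (g s) \<le> c + s" if s: "s \<in> {0..H}" for s
  proof -
    have in_l: "s \<in> {0..curve_length n \<alpha>}" "0 \<in> {0..curve_length n \<alpha>}" using s Hl by auto
    have "c \<le> bd (g s) + s"
      using bdist_arclength_point_le[OF rect im in_l] s by (simp add: c_def g_def)
    moreover have "s \<le> a * bd (g s)" using cone s by (simp add: H_def g_def)
    ultimately show "c + s \<le> A * bd (g s)" by (simp add: A_def algebra_simps)
    show "bd (g s) \<le> c + s"
      using bdist_arclength_point_le[OF rect im in_l(2,1)] s by (simp add: c_def g_def)
  qed
  have kle: "k (g s) (g t) \<le> A * (ln (c + t) - ln (c + s))" if st: "0 \<le> s" "s \<le> t" "t \<le> H" for s t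
  proof -
    have "(density \<alpha> has_integral integral {s..t} (density \<alpha>)) {s..t}"
      using density_integrable[OF rect im] st Hl by (intro integrable_integral) auto
    moreover have "((\<lambda>r. A * (1 / (c + r))) has_integral A * (ln (c + t) - ln (c + s))) {s..t}"
      using has_integral_inverse_affine[of s t c] st c0 by (intro has_integral_mult_right) auto
    ultimately have "integral {s..t} (density \<alpha>) \<le> A * (ln (c + t) - ln (c + s))"
    proof (rule has_integral_le)
      fix r assume "r \<in> {s..t}"
      then have r: "r \<in> {0..H}" using st by auto
      have "0 < bd (g r)" using bdist_pos gD r by blast
      then show "density \<alpha> r \<le> A * (1 / (c + r))"
        using low[OF r] c0 r by (simp add: density_def g_def divide_simps mult.commute)
    qed
    then show ?thesis
      using qh_dist_arclength_le[OF rect im, of s t] st Hl unfolding g_def by linarith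
  qed
  \<comment> \<open>Solves \<open>c + S i = 2 ^ i * c\<close>, capped at \<open>H\<close> so that
    the last rung is the midpoint of the cone arc.\<close>
  define S where "S i = min ((2 ^ i - 1) * c) H" for i :: nat
  have S_in: "S i \<in> {0..H}" for i using c0 H0 by (auto simp: S_def)
  have "\<exists>N::nat. H \<le> (2 ^ N - 1) * c"
  proof -
    obtain N :: nat where "H / c + 1 < 2 ^ N" using real_arch_pow[of 2 "H / c + 1"] by auto
    then have "H / c \<le> 2 ^ N - 1" by simp
    then show ?thesis using c0 by (auto simp: pos_divide_le_eq)
  qed
  define N where "N = (LEAST N::nat. H \<le> (2 ^ N - 1) * c)"
  have N: "H \<le> (2 ^ N - 1) * c" unfolding N_def using \<open>\<exists>N. _\<close> by (rule LeastI_ex)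
  have less_N: "(2 ^ i - 1) * c < H" if "i < N" for i
    using not_less_Least[of i "\<lambda>N. H \<le> (2 ^ N - 1) * c"] that by (simp add: N_def not_le)
  have S_less: "c + S i = 2 ^ i * c" if "i < N" for i
    using less_N[OF that] by (simp add: S_def algebra_simps)
  have S_le: "c + S i \<le> 2 ^ i * c" for i by (simp add: S_def min_def algebra_simps)
  \<comment> \<open>The capped last rung may fall short of doubling; minimality of \<open>N\<close>
    limits the loss to a factor 2.\<close>
  have S_ge: "2 ^ i * c \<le> 2 * (c + S i)" if "i \<le> N" for i
  proof (cases "i < N")
    case True then show ?thesis using S_less[OF True] c0 by simp
  next
    case False
    then have "i = N" using that by simp
    show ?thesis
    proof (cases N)
      case 0 then show ?thesis using \<open>i = N\<close> c0 S_in[of i] by simp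
    next
      case (Suc m)
      have "2 ^ m * c \<le> c + H" using less_N[of m] Suc by (simp add: algebra_simps)
      moreover have "S N = H" using N by (simp add: S_def)
      ultimately show ?thesis using \<open>i = N\<close> Suc by simp
    qed
  qed
  define z where "z i = g (S i)" for i
  have bdz: "bd (z i) > 0" for i unfolding z_def using bdist_pos gD S_in by blast
  have "height_space.ladder D k height A N z"
    unfolding height_space.ladder_def[OF hs[folded A_def]]
  proof (intro conjI allI impI)
    fix i show "z i \<in> D" unfolding z_def using gD S_in by blast
  next
    fix i assume i: "i < N"
    have "(2 ^ i - 1) * c \<le> (2 ^ Suc i - 1) * c" using c0 by (intro mult_right_mono) auto
    then have "S i \<le> S (Suc i)" by (auto simp: S_def)
    then have "k (z i) (z (Suc i)) \<le> A * (ln (c + S (Suc i)) - ln (c + S i))"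
      unfolding z_def using S_in[of i] S_in[of "Suc i"] by (intro kle) auto
    also have "\<dots> \<le> A * ln 2"
    proof (rule mult_left_mono)
      have "c + S (Suc i) \<le> 2 * (c + S i)" using S_le[of "Suc i"] S_less[OF i] by simp
      then have "ln (c + S (Suc i)) \<le> ln (2 * (c + S i))"
        using c0 S_in[of "Suc i"] S_in[of i] by simp
      moreover have "ln (2 * (c + S i)) = ln 2 + ln (c + S i)"
        using c0 S_in[of i] by (intro ln_mult_pos) auto
      ultimately show "ln (c + S (Suc i)) - ln (c + S i) \<le> ln 2" by linarith
    qed (use A3 in simp)
    also have "\<dots> \<le> A * 1" using A3 ln_2_less_1 by (intro mult_left_mono) auto
    finally show "k (z i) (z (Suc i)) \<le> A" by simp
  next
    fix i assume i: "i \<le> N"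
    have z0: "bd (z 0) = c" using H0 by (simp add: z_def S_def c_def)
    have "bd (z i) \<le> 2 ^ i * c" using up[OF S_in[of i]] S_le[of i] by (simp add: z_def)
    then have "ln (bd (z i)) \<le> ln (2 ^ i * c)" using bdz[of i] c0 by simp
    then have 1: "height (z i) \<le> i * ln 2 + ln c" using c0 by (simp add: ln_mult ln_realpow)
    have "2 ^ i * c \<le> (2 * A) * bd (z i)"
      using S_ge[OF i] low[OF S_in[of i]] by (simp add: z_def)
    then have "ln (2 ^ i * c) \<le> ln ((2 * A) * bd (z i))" using c0 A3 bdz[of i] by simp
    then have "i * ln 2 + ln c \<le> ln (2 * A) + height (z i)"
      using c0 A3 bdz[of i] by (simp add: ln_mult ln_realpow)
    \<comment> \<open>\<open>ln A \<le> A - 1\<close> and \<open>ln 2 < 1\<close>, so the one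
      constant \<open>A\<close> bounds both the steps and the height error.\<close>
    moreover have "ln (2 * A) \<le> A"
      using A3 ln_le_minus_one[of A] ln_2_less_1 by (simp add: ln_mult)
    ultimately show "\<bar>height (z i) - height (z 0) - i * ln 2\<bar> \<le> A"
      using 1 A3 unfolding z0 by linarith
  qed
  moreover have "z 0 = g 0" using H0 by (simp add: z_def S_def)
  moreover have "z N = g H" using N by (simp add: z_def S_def)
  ultimately show ?thesis unfolding g_def H_def A_def by blast
qed

lemma cone_arc_half:
  assumes "cone_arc n D a \<alpha>" "s \<in> {0..curve_length n \<alpha>}"
  shows "min s (curve_length n \<alpha> - s) \<le> a * bd (arclength_point n \<alpha> s)"
proof -
  have rect: "rectifiable n \<alpha>" and im: "path_image \<alpha> \<subseteq> D" using assms by (auto simp: cone_arc_def)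
  obtain t where t: "t \<in> {0..1}" "arc_length n \<alpha> t = s" using arc_length_surj[OF rect assms(2)] .
  have "min (curve_length n (subcurve 0 t \<alpha>)) (curve_length n (subcurve t 1 \<alpha>)) \<le> a * bd (\<alpha> t)"
    using assms(1) t by (simp add: cone_arc_def)
  then show ?thesis
    using t arclength_point_arc_length[OF rect D_curve[OF im] t(1)] curve_length_subcurve[OF rect, of t 1] rect
    by (simp add: arc_length_def)
qed

text \<open>The additive height error \<open>C\<close> becomes the factor \<open>exp C\<close> in
  \<open>bd\<close>, and decay at rate \<open>1 / (2 * (2 * a + 1))\<close> integrates to the factor
  in front.\<close>

lemma qh_geodesic_cone_arc:
  assumes hs: "height_space D k \<delta> height (2 * a + 1) R" and a: "a \<ge> 1" and "John n D a"
    and geo: "qh_geodesic n D \<gamma>"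
  defines "C \<equiv> 2 * (2 * a + 1) + 8 * (R + \<delta>)"
  shows "cone_arc n D (2 * (2 * a + 1) * exp C) \<gamma>"
proof -
  define ladder where "ladder = height_space.ladder D k height (2 * a + 1)"
  note half_ladder = cone_arc_half_ladder[OF hs a, folded ladder_def]
  note height_growth = height_space.height_growth_along_geodesic[OF hs, folded ladder_def]
  have arc: "arc \<gamma>" and im: "path_image \<gamma> \<subseteq> D" and rect: "rectifiable n \<gamma>"
    and kuv: "\<And>u v. u \<in> {0..1} \<Longrightarrow> v \<in> {0..1} \<Longrightarrow> qh_length n D (subcurve u v \<gamma>) = k (\<gamma> u) (\<gamma> v)"
    using geo by (auto simp: qh_geodesic_def)
  define l g where "l = curve_length n \<gamma>" and "g = arclength_point n \<gamma>"
  \<comment> \<open>On a geodesic, \<open>G\<close> is the \<open>k\<close>-distance from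
    \<open>x\<close> as a function of arc length; its derivative \<open>1 / bd\<close> links
    Euclidean and quasihyperbolic length.\<close>
  define G where "G s = integral {0..s} (density \<gamma>)" for s
  have l0: "l \<ge> 0" using curve_length_nonneg[OF rect im] by (simp add: l_def)
  have gD: "g s \<in> D" if "s \<in> {0..l}" for s
    using arclength_point_in_D[OF rect im] that by (simp add: g_def l_def)
  have gL: "g (arc_length n \<gamma> t) = \<gamma> t" if "t \<in> {0..1}" for t
    using arclength_point_arc_length[OF rect D_curve[OF im] that] by (simp add: g_def)
  define x y where "x = \<gamma> 0" and "y = \<gamma> 1"
  have gx: "g 0 = x" "g l = y" using gL[of 0] gL[of 1] rect by (auto simp: x_def y_def l_def)
  have xy: "x \<in> D" "y \<in> D" "x \<noteq> y"
    using im arc arc_distinct_ends[OF arc]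
    by (auto simp: path_image_def x_def y_def pathstart_def pathfinish_def)
  have G_diff: "integral {s..t} (density \<gamma>) = G t - G s" if "0 \<le> s" "s \<le> t" "t \<le> l" for s t
    using Henstock_Kurzweil_Integration.integral_combine[of 0 s t "density \<gamma>"] that
      density_integrable[OF rect im, of 0 t] by (simp add: G_def l_def)
  have G_mono: "G s \<le> G t" if "0 \<le> s" "s \<le> t" "t \<le> l" for s t
    using G_diff[OF that] integral_density_nonneg[OF rect im, of s t] that by (simp add: l_def)
  have kG1: "k (g s) (g t) = G t - G s" if "0 \<le> s" "s \<le> t" "t \<le> l" for s t
  proof (cases "s = t")
    case True then show ?thesis using qh_dist_refl gD that by simp
  next
    case False
    have st: "s \<in> {0..curve_length n \<gamma>}" "t \<in> {0..curve_length n \<gamma>}" using that by (auto simp: l_def)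
    obtain u where u: "u \<in> {0..1}" "arc_length n \<gamma> u = s" using arc_length_surj[OF rect st(1)] .
    obtain v where v: "v \<in> {0..1}" "arc_length n \<gamma> v = t" using arc_length_surj[OF rect st(2)] .
    have "u \<le> v" using arc_length_mono[OF rect, of v u] u v that False by force
    then show ?thesis
      using qh_length_subcurve[OF rect im, of u v] kuv[OF u(1) v(1)] gL[OF u(1)] gL[OF v(1)] u v
        G_diff[OF that] by simp
  qed
  have kG: "k (g s) (g t) = \<bar>G s - G t\<bar>" if "s \<in> {0..l}" "t \<in> {0..l}" for s t
    using kG1[of s t] kG1[of t s] G_mono[of s t] G_mono[of t s] that qh_dist_commute[of "g s" "g t"]
    by (cases "s \<le> t") auto
  have G0: "G 0 = 0" by (simp add: G_def)
  have kxy: "k x y = G l" using kG1[of 0 l] l0 gx G0 by simp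
  have contG: "continuous_on {0..l} G"
    unfolding G_def by (intro indefinite_integral_continuous_1 density_integrable[OF rect im]) (auto simp: l_def)
  have seg: "geodesic_segment D k x y (g ` {0..l})"
  proof -
    have "\<exists>\<sigma>\<in>{0..l}. G \<sigma> = u" if "u \<in> {0..G l}" for u
      using IVT'[of G 0 u l] contG l0 that G0 by force
    then obtain \<sigma> where \<sigma>: "\<And>u. u \<in> {0..G l} \<Longrightarrow> \<sigma> u \<in> {0..l}" "\<And>u. u \<in> {0..G l} \<Longrightarrow> G (\<sigma> u) = u"
      by metis
    have Gl: "G s \<in> {0..G l}" if "s \<in> {0..l}" for s
      using G_mono[of 0 s] G_mono[of s l] that G0 by auto
    \<comment> \<open>\<open>\<sigma>\<close> comes from the intermediate value theorem and is only
      a right inverse of \<open>G\<close>; composed with \<open>g\<close> it is also a left inverse,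
      because \<open>k\<close> separates points.\<close>
    have g\<sigma>: "g (\<sigma> (G s)) = g s" if s: "s \<in> {0..l}" for s
    proof (rule qh_dist_eq_0)
      show "k (g (\<sigma> (G s))) (g s) \<le> 0" using kG[OF \<sigma>(1)[OF Gl[OF s]] s] \<sigma>(2)[OF Gl[OF s]] by simp
    qed (use gD s \<sigma>(1)[OF Gl[OF s]] in auto)
    have img: "(\<lambda>u. g (\<sigma> u)) ` {0..G l} = g ` {0..l}"
    proof
      show "(\<lambda>u. g (\<sigma> u)) ` {0..G l} \<subseteq> g ` {0..l}" using \<sigma>(1) by blast
      show "g ` {0..l} \<subseteq> (\<lambda>u. g (\<sigma> u)) ` {0..G l}"
        using g\<sigma> Gl by (intro image_subsetI) (metis image_eqI)
    qed
    show ?thesis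
      unfolding geodesic_segment_def kxy
    proof (intro exI[of _ "\<lambda>u. g (\<sigma> u)"] conjI ballI)
      show "g (\<sigma> 0) = x" using g\<sigma>[of 0] l0 G0 gx by simp
      show "g (\<sigma> (G l)) = y" using g\<sigma>[of l] l0 gx by simp
      show "g ` {0..l} \<subseteq> D" using gD by blast
      fix u v assume "u \<in> {0..G l}" "v \<in> {0..G l}"
      then show "k (g (\<sigma> u)) (g (\<sigma> v)) = \<bar>u - v\<bar>" using kG \<sigma> by simp
    qed (rule img)
  qed
  obtain \<alpha> where \<alpha>: "cone_arc n D a \<alpha>" "pathstart \<alpha> = x" "pathfinish \<alpha> = y"
    using \<open>John n D a\<close> xy by (auto simp: John_def)
  have rect\<alpha>: "rectifiable n \<alpha>" and im\<alpha>: "path_image \<alpha> \<subseteq> D" using \<alpha> by (auto simp: cone_arc_def)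
  note E\<alpha> = D_curve[OF im\<alpha>]
  have l\<alpha>0: "0 \<le> curve_length n \<alpha>" using curve_length_nonneg[OF rect\<alpha> im\<alpha>] .
  define m where "m = arclength_point n \<alpha> (curve_length n \<alpha> / 2)"
  have ends: "arclength_point n \<alpha> 0 = x" "arclength_point n \<alpha> (curve_length n \<alpha>) = y"
    using arclength_point_arc_length[OF rect\<alpha> E\<alpha>, of 0] arclength_point_arc_length[OF rect\<alpha> E\<alpha>, of 1]
      rect\<alpha> \<alpha> by (auto simp: pathstart_def pathfinish_def)
  have "\<exists>N z. ladder N z \<and> z 0 = x \<and> z N = m"
  proof -
    have "s \<le> a * bd (arclength_point n \<alpha> s)" if "s \<in> {0..curve_length n \<alpha> / 2}" for s
      using cone_arc_half[OF \<alpha>(1), of s] that by (auto simp: min_def split: if_splits)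
    then show ?thesis using half_ladder[OF rect\<alpha> im\<alpha>] ends by (simp add: m_def)
  qed
  then obtain N z where z: "ladder N z" "z 0 = x" "z N = m" by blast
  have "\<exists>N w. ladder N w \<and> w 0 = y \<and> w N = m"
  proof -
    \<comment> \<open>Reversal starts the second ladder at \<open>y\<close>. Both ladders end at
      \<open>m\<close>, as half the length is reached at the same point from either end.\<close>
    let ?\<rho> = "reversepath \<alpha>"
    have rev: "arclength_point n ?\<rho> s = arclength_point n \<alpha> (curve_length n \<alpha> - s)"
      if "s \<in> {0..curve_length n \<alpha>}" for s
      using arclength_point_reversepath[OF rect\<alpha> E\<alpha> that] .
    have "s \<le> a * bd (arclength_point n ?\<rho> s)" if "s \<in> {0..curve_length n ?\<rho> / 2}" for s
      using cone_arc_half[OF \<alpha>(1), of "curve_length n \<alpha> - s"] that rev[of s]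
      by (auto simp: curve_length_reversepath min_def split: if_splits)
    then have "\<exists>N w. ladder N w \<and> w 0 = arclength_point n ?\<rho> 0 \<and>
        w N = arclength_point n ?\<rho> (curve_length n ?\<rho> / 2)"
      using im\<alpha> by (intro half_ladder[OF rectifiable_reversepath[OF rect\<alpha>]]) auto
    moreover have "arclength_point n ?\<rho> 0 = y"
      using rev[of 0] l\<alpha>0 ends by simp
    moreover have "arclength_point n ?\<rho> (curve_length n ?\<rho> / 2) = m"
      using rev[of "curve_length n \<alpha> / 2"] l\<alpha>0 by (simp add: curve_length_reversepath m_def)
    ultimately show ?thesis by simp
  qed
  then obtain N' w where w: "ladder N' w" "w 0 = y" "w N' = m" by blast
  have bound: "min s0 (l - s0) \<le> 2 * (2 * a + 1) * exp C * bd (g s0)" if s0: "s0 \<in> {0..l}" for s0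
  proof -
    define \<kappa> P where "\<kappa> = 2 * (2 * a + 1)" and "P = bd (g s0) * exp C"
    have b0: "bd (g s0) > 0" using bdist_pos gD s0 by blast
    have \<kappa>: "\<kappa> > 0" and P: "P > 0" using a b0 by (auto simp: \<kappa>_def P_def)
    have deriv: "(G has_real_derivative 1 / bd (g r)) (at r within {s..t})"
      if "0 \<le> s" "t \<le> l" "r \<in> {s..t}" for r s t
    proof -
      have "(G has_real_derivative density \<gamma> r) (at r within {0..l})"
        unfolding G_def using continuous_on_density[OF rect im] that
        by (intro integral_has_real_derivative) (auto simp: l_def)
      then show ?thesis
        using that by (auto simp: density_def g_def intro: DERIV_subset)
    qed
    have decay: "bd (g r) \<le> P * exp (- \<bar>G r - G s0\<bar> / \<kappa>)"
      if r: "r \<in> {0..l}" and h: "height (g r) \<le> height (g s0) - k (g r) (g s0) / \<kappa> + C" for r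
    proof -
      have "bd (g r) > 0" using bdist_pos gD r by blast
      then have "bd (g r) = exp (height (g r))" by simp
      also have "\<dots> \<le> exp (height (g s0) + C + - \<bar>G r - G s0\<bar> / \<kappa>)"
        using h kG[OF r s0] by simp
      also have "\<dots> = P * exp (- \<bar>G r - G s0\<bar> / \<kappa>)"
        unfolding exp_add P_def using b0 by simp
      finally show ?thesis .
    qed
    have in_seg: "g r \<in> g ` {0..l}" if "r \<in> {0..l}" for r using that by blast
    consider "\<forall>q\<in>g ` {0..l}. k x q \<le> k x (g s0) \<longrightarrow> height q \<le> height (g s0) - k q (g s0) / \<kappa> + C"
      | "\<forall>q\<in>g ` {0..l}. k y q \<le> k y (g s0) \<longrightarrow> height q \<le> height (g s0) - k q (g s0) / \<kappa> + C"
      using height_growth[OF z w seg in_seg[OF s0]]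
      by (auto simp: \<kappa>_def C_def add.assoc)
    \<comment> \<open>Only the side on which heights decay away from \<open>g s0\<close> gets
      bounded, and the minimum asks for no more.\<close>
    then have "s0 \<le> \<kappa> * P \<or> l - s0 \<le> \<kappa> * P"
    proof cases
      case 1
      have "s0 - 0 \<le> \<kappa> * P"
      proof (rule interval_length_le_exp_decay[where G=G and b="\<lambda>r. bd (g r)" and \<epsilon>=1 and c="G s0"])
        fix r assume r: "r \<in> {0..s0}"
        then have rl: "r \<in> {0..l}" using s0 by simp
        have Gr: "G r \<le> G s0" "0 \<le> G r"
          using G_mono[of r s0] G_mono[of 0 r] r s0 G0 by auto
        have "k x (g r) \<le> k x (g s0)"
          using kG[of 0 r] kG[of 0 s0] rl s0 l0 gx Gr G0 by simp
        then have "height (g r) \<le> height (g s0) - k (g r) (g s0) / \<kappa> + C" using 1 rl by blast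
        from decay[OF rl this] show "bd (g r) \<le> P * exp (1 * (G r - G s0) / \<kappa>)" using Gr by simp
        show "1 * (G r - G s0) \<le> 0" using Gr by simp
        show "0 < bd (g r)" using bdist_pos gD rl by blast
        show "(G has_real_derivative 1 / bd (g r)) (at r within {0..s0})" using deriv r s0 by simp
      qed (use s0 \<kappa> P in auto)
      then show ?thesis by simp
    next
      case 2
      have "l - s0 \<le> \<kappa> * P"
      proof (rule interval_length_le_exp_decay[where G=G and b="\<lambda>r. bd (g r)" and \<epsilon>="-1" and c="G s0"])
        fix r assume r: "r \<in> {s0..l}"
        then have rl: "r \<in> {0..l}" using s0 by simp
        have Gr: "G s0 \<le> G r" "G r \<le> G l"
          using G_mono[of s0 r] G_mono[of r l] r s0 by auto
        have "k y (g r) \<le> k y (g s0)"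
          using kG[of l r] kG[of l s0] rl s0 l0 gx Gr by simp
        then have "height (g r) \<le> height (g s0) - k (g r) (g s0) / \<kappa> + C" using 2 rl by blast
        from decay[OF rl this] show "bd (g r) \<le> P * exp (- 1 * (G r - G s0) / \<kappa>)" using Gr by simp
        show "- 1 * (G r - G s0) \<le> 0" using Gr by simp
        show "0 < bd (g r)" using bdist_pos gD rl by blast
        show "(G has_real_derivative 1 / bd (g r)) (at r within {s0..l})" using deriv r s0 by simp
      qed (use s0 \<kappa> P in auto)
      then show ?thesis by simp
    qed
    then show ?thesis by (auto simp: \<kappa>_def P_def mult_ac)
  qed
  have "min (curve_length n (subcurve 0 t \<gamma>)) (curve_length n (subcurve t 1 \<gamma>))
      \<le> 2 * (2 * a + 1) * exp C * bd (\<gamma> t)" if t: "t \<in> {0..1}" for t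
  proof -
    have "arc_length n \<gamma> t \<in> {0..l}"
      using arc_length_mono[OF rect, of 0 t] arc_length_mono[OF rect, of t 1] t rect by (auto simp: l_def)
    from bound[OF this] show ?thesis
      using gL[OF t] curve_length_subcurve[OF rect, of t 1] t rect
      by (simp add: l_def flip: arc_length_def)
  qed
  then show ?thesis using arc im rect by (simp add: cone_arc_def)
qed

end

section \<open>John domains and the uniform constant\<close>

lemma John_connected_subdomain:
  assumes "proper_subdomain n D" "John n D a"
  shows "connected_subdomain n D"
proof (rule connected_subdomain.intro)
  show D: "subdomain n D" using assms(1) by (rule subdomain.intro)
  show "connected_subdomain_axioms n D"
  proof (rule connected_subdomain_axioms.intro)
    fix x y assume xy: "x \<in> D" "y \<in> D"
    show "\<exists>\<gamma>. subdomain.joining n D x y \<gamma>"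
    proof (cases "x = y")
      case True
      \<comment> \<open>Cone arcs have distinct endpoints, so the degenerate segment joins
        \<open>x\<close> to itself.\<close>
      obtain r where "r > 0" "\<And>w. w \<in> D \<Longrightarrow> edist n x w < r \<Longrightarrow> \<exists>\<gamma>. subdomain.joining n D x w \<gamma>"
        using subdomain.short_segment[OF D xy(1)] by metis
      then show ?thesis using xy True by simp
    next
      case False
      then obtain \<alpha> where "cone_arc n D a \<alpha>" "pathstart \<alpha> = x" "pathfinish \<alpha> = y"
        using assms(2) xy unfolding John_def by blast
      then have "subdomain.joining n D x y \<alpha>"
        by (simp add: subdomain.joining_def[OF D] cone_arc_def)
      then show ?thesis by blast
    qed
  qed
qed

theorem corollary1p1:
  fixes a \<delta> :: real
  assumes "a \<ge> 1" and "\<delta> \<ge> 0"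
  shows "\<exists>b\<ge>1. \<forall>n\<ge>1. \<forall>D.
           proper_subdomain n D \<and> John n D a \<and> hyperbolic_domain n D \<delta> \<longrightarrow>
           (\<forall>\<gamma>. qh_geodesic n D \<gamma> \<longrightarrow> cone_arc n D b \<gamma>)"
proof -
  define K where "K = 2 * a + 1"
  \<comment> \<open>\<open>R\<close>, and with it \<open>b\<close>, is fixed from \<open>a\<close>
    and \<open>\<delta>\<close> before \<open>n\<close> and \<open>D\<close> appear.\<close>
  obtain R where R: "R \<ge> 0"
    "\<And>r. r \<ge> 0 \<Longrightarrow> (\<And>m::nat. 12 * r + 4 * K \<le> 2 ^ m \<Longrightarrow> r \<le> 2 * \<delta> + \<delta> * m + K) \<Longrightarrow> r \<le> R"
    using log_absorption[of 12 "4 * K" \<delta> K] assms by (auto simp: K_def)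
  define b where "b = 2 * K * exp (2 * K + 8 * (R + \<delta>))"
  have "1 * 1 \<le> b" unfolding b_def using assms R(1) by (intro mult_mono) (auto simp: K_def)
  moreover have "cone_arc n D b \<gamma>"
    if D: "proper_subdomain n D" "John n D a" "hyperbolic_domain n D \<delta>" and \<gamma>: "qh_geodesic n D \<gamma>"
    for n D \<gamma>
  proof -
    have cs: "connected_subdomain n D" using John_connected_subdomain D by blast
    have "height_space D (qh_dist n D) \<delta> (\<lambda>z. ln (bdist n D z)) (2 * a + 1) R"
    proof (intro height_space.intro hyperbolic_geodesic_space.intro
        hyperbolic_geodesic_space_axioms.intro height_space_axioms.intro)
      show "geodesic_space D (qh_dist n D)" by (rule connected_subdomain.geodesic_space_qh[OF cs])
      show "\<delta> \<ge> 0" by (rule assms)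
      show "hyperbolic_space D (qh_dist n D) \<delta>" using D by (simp add: hyperbolic_domain_def)
      show "2 * a + 1 \<ge> 1" using assms by simp
      show "R \<ge> 0" by (rule R)
      show "\<bar>ln (bdist n D p) - ln (bdist n D q)\<bar> \<le> qh_dist n D p q" if "p \<in> D" "q \<in> D" for p q
        using connected_subdomain.ln_bdist_lipschitz[OF cs that] .
      show "r \<le> R" if "r \<ge> 0"
        "\<And>m::nat. 12 * r + 4 * (2 * a + 1) \<le> 2 ^ m \<Longrightarrow> r \<le> 2 * \<delta> + \<delta> * m + (2 * a + 1)" for r
        using R(2)[OF that(1)] that(2) by (simp add: K_def)
    qed
    from connected_subdomain.qh_geodesic_cone_arc[OF cs this assms(1) D(2) \<gamma>]
    show ?thesis by (simp add: b_def K_def)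
  qed
  ultimately show ?thesis by (intro exI[of _ b]) auto
qed

end
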